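(* Suppose $f$, $c$ and $\mathcal{A}$ are twice differentiable in $\mathbb{R}^n$. Any second-order stationary point of (OCP) is a second-order stationary point of (CDF). On the other hand, for any given $x\in\mathcal{M}$, if $\beta\ge\beta_x$ and $y\in\Omega_x$ is a second-order stationary point of (CDF), then $y$ is a second-order stationary point of (OCP).
   Context: Setting. $\|\cdot\|$ is the $\ell_2$-norm of vectors or the induced operator norm. Let $f:\mathbb{R}^n\to\mathbb{R}$, $c:\mathbb{R}^n\to\mathbb{R}^p$ be differentiable, $\mathcal{M}=\{x\in\mathbb{R}^n: c(x)=0\}$, and consider the problem (OCP): minimize $f(x)$ subject to $c(x)=0$. $J_c(x)\in\mathbb{R}^{n\times p}$ is the transposed Jacobian of $c$ (entry $(i,j)$ is $\partial c_j/\partial x_i$). Assumed: $\nabla f$ and $J_c$ are locally Lipschitz continuous on $\mathbb{R}^n$, and $J_c(x)$ has full column rank for every $x\in\mathcal{M}$. Let $\mathcal{A}:\mathbb{R}^n\to\mathbb{R}^n$ be differentiable with transposed Jacobian $J_{\mathcal{A}}(x)\in\mathbb{R}^{n\times n}$ (entry $(i,j)$ is $\partial\mathcal{A}_j/\partial x_i$), such that $J_{\mathcal{A}}$ is locally Lipschitz continuous on $\mathbb{R}^n$, $\mathcal{A}(x)=x$ for $x\in\mathcal{M}$, and $J_{\mathcal{A}}(x)J_c(x)=0$ for $x\in\mathcal{M}$. Put $g(x)=f(\mathcal{A}(x))$ and, with penalty parameter $\beta$, $h(x)=f(\mathcal{A}(x))+\frac{\beta}{2}\|c(x)\|^2$;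 (CDF) is the problem of minimizing $h$ over $\mathbb{R}^n$. $\nabla f(\mathcal{A}(y))$ denotes $\nabla f$ evaluated at $\mathcal{A}(y)$. Constants. For $x\in\mathcal{M}$, $\rho_x$ is the largest $\rho\in(0,1]$ with $\inf\{\sigma_{\min}(J_c(y)):y\in\mathbb{R}^n,\ \|y-x\|\le\rho\}\ge\frac12\sigma_{\min}(J_c(x))$ ($\sigma_{\min}$ = smallest singular value); $\Theta_x=\{y\in\mathbb{R}^n:\|y-x\|\le\rho_x\}$; $\sigma_{x,c}=\sigma_{\min}(J_c(x))$; $M_{x,f}=\sup_{y\in\Theta_x}\|\nabla f(\mathcal{A}(y))\|$; $M_{x,c}=\sup_{y\in\Theta_x}\|J_c(y)\|$; $M_{x,A}=\sup_{y\in\Theta_x}\|J_{\mathcal{A}}(y)\|$; $L_{x,g},L_{x,c},L_{x,A},L_{x,b}$ are the least Lipschitz constants on $\Theta_x$ (suprema of difference quotients over $y\ne z$ in $\Theta_x$) of $\nabla g$, $J_c$, $J_{\mathcal{A}}$, and $y\mapsto J_{\mathcal{A}}(y)J_c(\mathcal{A}(y))$ respectively. Put $$\varepsilon_x=\min\Big\{\frac{\rho_x}{2},\ \frac{\sigma_{x,c}}{32L_{x,c}(M_{x,A}+1)},\ \frac{\sigma_{x,c}^2}{8L_{x,b}M_{x,c}}\Big\},$$ $\Omega_x=\{y\in\mathbb{R}^n:\|y-x\|\le\varepsilon_x\}$, and $$\beta_x=\max\Big\{\frac{128L_{x,g}(M_{x,A}+1)^2}{\sigma_{x,c}^2},\ \frac{64M_{x,f}(M_{x,A}+1)L_{x,b}}{\sigma_{x,c}^3},\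 \frac{16M_{x,f}L_{x,A}(2M_{x,A}+1)}{\sigma_{x,c}^2}\Big\}.$$ Stationarity. $x$ is a first-order stationary point of (OCP) if $c(x)=0$ and $\nabla f(x)=\sum_{i=1}^p\tilde\lambda_i\nabla c_i(x)$ for some $\tilde\lambda\in\mathbb{R}^p$. For $x\in\mathcal{M}$, $\lambda(x)=(J_c(x)^\top J_c(x))^{-1}J_c(x)^\top\nabla f(x)$ and $\mathcal{T}_x=\{d\in\mathbb{R}^n:d^\top J_c(x)=0\}$. $x$ is a second-order stationary point of (OCP) if it is a first-order stationary point of (OCP) and $d^\top(\nabla^2f(x)-\sum_{i=1}^p\lambda_i(x)\nabla^2c_i(x))d\ge0$ for all $d\in\mathcal{T}_x$. $x$ is a second-order stationary point of (CDF) if $\nabla h(x)=0$ and $\nabla^2h(x)\succeq0$.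
   Formalization: The first claim fails for arbitrary β (f(t)=t, c(t)=t, A(t)=-t², β=1 at 0); it is proved for second-order stationary points z of (OCP) with z∈Ω_x and β≥β_x for some x∈M (e.g. x=z). The penalty parameter β is taken positive throughout. *)

theory Defs
  imports "HOL-Analysis.Analysis"
begin

section \<open>Derivatives\<close>

definition grad :: "(real^'n \<Rightarrow> real) \<Rightarrow> real^'n \<Rightarrow> real^'n" where
  "grad f x = (\<chi> i. frechet_derivative f (at x) (axis i 1))"

text \<open>Transposed Jacobian: entry \<open>(i,j)\<close> is the derivative of \<open>F\<^sub>j\<close> in direction \<open>x\<^sub>i\<close>.\<close>
definition trjac :: "(real^'n \<Rightarrow> real^'m) \<Rightarrow> real^'n \<Rightarrow> real^'m^'n" where
  "trjac F x = transpose (jacobian F (at x))"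

definition hess :: "(real^'n \<Rightarrow> real) \<Rightarrow> real^'n \<Rightarrow> real^'n^'n" where
  "hess f x = jacobian (grad f) (at x)"

section \<open>Norms, Lipschitz constants, singular values\<close>

text \<open>The library norm on matrices is the Frobenius norm, so the induced norm is introduced
  separately. Local Lipschitz continuity does not depend on which of the two is used.\<close>
definition opnorm :: "real^'n^'m \<Rightarrow> real" where
  "opnorm M = onorm ((*v) M)"

definition locally_lipschitz :: "('a::metric_space \<Rightarrow> 'b::metric_space) \<Rightarrow> bool" where
  "locally_lipschitz F \<longleftrightarrow> (\<forall>x. \<exists>r>0. \<exists>L. L-lipschitz_on (cball x r) F)"

text \<open>\<open>N\<close> is the norm used on the codomain.\<close>
definition lip_const ::
    "('b::minus \<Rightarrow> real) \<Rightarrow> 'a::real_normed_vector set \<Rightarrow> ('a \<Rightarrow> 'b) \<Rightarrow> real" where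
  "lip_const N S F =
     (SUP (y, z) \<in> {(y, z). y \<in> S \<and> z \<in> S \<and> y \<noteq> z}. N (F y - F z) / norm (y - z))"

text \<open>Singular values as square roots of the eigenvalues of \<open>M\<^sup>T M\<close>. This lists all
  \<open>CARD('p)\<close> singular values when \<open>CARD('p) \<le> CARD('n)\<close>, the only case that matters below:
  a single feasible point where the transposed Jacobian has full column rank forces it.\<close>
definition singular_value :: "real^'p^'n \<Rightarrow> real \<Rightarrow> bool" where
  "singular_value M s \<longleftrightarrow>
     0 \<le> s \<and> (\<exists>v. v \<noteq> 0 \<and> (transpose M ** M) *v v = s\<^sup>2 *s v)"

definition sigma_min :: "real^'p^'n \<Rightarrow> real" where
  "sigma_min M = (LEAST s. singular_value M s)"

section \<open>Constants attached to a feasible point\<close>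

definition feasible_set :: "(real^'n \<Rightarrow> real^'p) \<Rightarrow> (real^'n) set" where
  "feasible_set c = {x. c x = 0}"

definition rho :: "(real^'n \<Rightarrow> real^'p) \<Rightarrow> real^'n \<Rightarrow> real" where
  "rho c x = (GREATEST r. r \<in> {0<..1} \<and>
     (INF y \<in> {y. norm (y - x) \<le> r}. sigma_min (trjac c y)) \<ge> sigma_min (trjac c x) / 2)"

definition Theta :: "(real^'n \<Rightarrow> real^'p) \<Rightarrow> real^'n \<Rightarrow> (real^'n) set" where
  "Theta c x = {y. norm (y - x) \<le> rho c x}"

definition sigma_c :: "(real^'n \<Rightarrow> real^'p) \<Rightarrow> real^'n \<Rightarrow> real" where
  "sigma_c c x = sigma_min (trjac c x)"

definition M_f ::
    "(real^'n \<Rightarrow> real) \<Rightarrow> (real^'n \<Rightarrow> real^'p) \<Rightarrow> (real^'n \<Rightarrow> real^'n) \<Rightarrow> real^'n \<Rightarrow> real" where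
  "M_f f c A x = (SUP y \<in> Theta c x. norm (grad f (A y)))"

definition M_c :: "(real^'n \<Rightarrow> real^'p) \<Rightarrow> real^'n \<Rightarrow> real" where
  "M_c c x = (SUP y \<in> Theta c x. opnorm (trjac c y))"

definition M_A :: "(real^'n \<Rightarrow> real^'p) \<Rightarrow> (real^'n \<Rightarrow> real^'n) \<Rightarrow> real^'n \<Rightarrow> real" where
  "M_A c A x = (SUP y \<in> Theta c x. opnorm (trjac A y))"

definition L_g ::
    "(real^'n \<Rightarrow> real) \<Rightarrow> (real^'n \<Rightarrow> real^'p) \<Rightarrow> (real^'n \<Rightarrow> real^'n) \<Rightarrow> real^'n \<Rightarrow> real" where
  "L_g f c A x = lip_const norm (Theta c x) (grad (\<lambda>y. f (A y)))"

definition L_c :: "(real^'n \<Rightarrow> real^'p) \<Rightarrow> real^'n \<Rightarrow> real" where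
  "L_c c x = lip_const opnorm (Theta c x) (trjac c)"

definition L_A :: "(real^'n \<Rightarrow> real^'p) \<Rightarrow> (real^'n \<Rightarrow> real^'n) \<Rightarrow> real^'n \<Rightarrow> real" where
  "L_A c A x = lip_const opnorm (Theta c x) (trjac A)"

definition L_b :: "(real^'n \<Rightarrow> real^'p) \<Rightarrow> (real^'n \<Rightarrow> real^'n) \<Rightarrow> real^'n \<Rightarrow> real" where
  "L_b c A x = lip_const opnorm (Theta c x) (\<lambda>y. trjac A y ** trjac c (A y))"

text \<open>The Lipschitz constants in the denominators may vanish (e.g. for affine \<open>c\<close>). The quotient
  is then to be read as infinity, i.e. it imposes no bound; hence the extended reals.\<close>
definition eps_x ::
    "(real^'n \<Rightarrow> real^'p) \<Rightarrow> (real^'n \<Rightarrow> real^'n) \<Rightarrow> real^'n \<Rightarrow> ereal" where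
  "eps_x c A x =
     min (ereal (rho c x / 2))
       (min (ereal (sigma_c c x) / ereal (32 * L_c c x * (M_A c A x + 1)))
            (ereal ((sigma_c c x)\<^sup>2) / ereal (8 * L_b c A x * M_c c x)))"

definition Omega ::
    "(real^'n \<Rightarrow> real^'p) \<Rightarrow> (real^'n \<Rightarrow> real^'n) \<Rightarrow> real^'n \<Rightarrow> (real^'n) set" where
  "Omega c A x = {y. ereal (norm (y - x)) \<le> eps_x c A x}"

definition beta_x ::
    "(real^'n \<Rightarrow> real) \<Rightarrow> (real^'n \<Rightarrow> real^'p) \<Rightarrow> (real^'n \<Rightarrow> real^'n) \<Rightarrow> real^'n \<Rightarrow> real" where
  "beta_x f c A x =
     max (128 * L_g f c A x * (M_A c A x + 1)\<^sup>2 / (sigma_c c x)\<^sup>2)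
       (max (64 * M_f f c A x * (M_A c A x + 1) * L_b c A x / (sigma_c c x) ^ 3)
            (16 * M_f f c A x * L_A c A x * (2 * M_A c A x + 1) / (sigma_c c x)\<^sup>2))"

section \<open>Stationarity\<close>

definition penalty ::
    "real \<Rightarrow> (real^'n \<Rightarrow> real) \<Rightarrow> (real^'n \<Rightarrow> real^'p) \<Rightarrow> (real^'n \<Rightarrow> real^'n) \<Rightarrow> real^'n \<Rightarrow> real"
  where "penalty \<beta> f c A x = f (A x) + \<beta> / 2 * (norm (c x))\<^sup>2"

definition first_order_OCP ::
    "(real^'n \<Rightarrow> real) \<Rightarrow> (real^'n \<Rightarrow> real^'p) \<Rightarrow> real^'n \<Rightarrow> bool" where
  "first_order_OCP f c x \<longleftrightarrow>
     c x = 0 \<and> (\<exists>l::real^'p. grad f x = (\<Sum>i\<in>UNIV. (l $ i) *\<^sub>R grad (\<lambda>y. c y $ i) x))"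

definition multiplier ::
    "(real^'n \<Rightarrow> real) \<Rightarrow> (real^'n \<Rightarrow> real^'p) \<Rightarrow> real^'n \<Rightarrow> real^'p" where
  "multiplier f c x =
     matrix_inv (transpose (trjac c x) ** trjac c x) *v (transpose (trjac c x) *v grad f x)"

definition tangent :: "(real^'n \<Rightarrow> real^'p) \<Rightarrow> real^'n \<Rightarrow> (real^'n) set" where
  "tangent c x = {d. d v* trjac c x = 0}"

definition second_order_OCP ::
    "(real^'n \<Rightarrow> real) \<Rightarrow> (real^'n \<Rightarrow> real^'p) \<Rightarrow> real^'n \<Rightarrow> bool" where
  "second_order_OCP f c x \<longleftrightarrow>
     first_order_OCP f c x \<and>
     (\<forall>d \<in> tangent c x.
        d \<bullet> ((hess f x - (\<Sum>i\<in>UNIV. (multiplier f c x $ i) *\<^sub>R hess (\<lambda>y. c y $ i) x)) *v d) \<ge> 0)"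

definition second_order_CDF ::
    "real \<Rightarrow> (real^'n \<Rightarrow> real) \<Rightarrow> (real^'n \<Rightarrow> real^'p) \<Rightarrow> (real^'n \<Rightarrow> real^'n) \<Rightarrow> real^'n \<Rightarrow> bool"
  where
  "second_order_CDF \<beta> f c A x \<longleftrightarrow>
     grad (penalty \<beta> f c A) x = 0 \<and> (\<forall>d. d \<bullet> (hess (penalty \<beta> f c A) x *v d) \<ge> 0)"

end

theory Submission
  imports Defs
begin

text \<open>Write \<open>J\<close> for \<open>trjac c z\<close> and \<open>P\<close> for \<open>trjac A z\<close> at a feasible point \<open>z\<close>; a row vector acts on
the left, so \<open>d v* P\<close> is the directional derivative of \<open>A\<close> along \<open>d\<close>.

\<^bold>\<open>Geometry.\<close> The feasible set has a curve through \<open>z\<close> in every tangent direction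
(\<open>tangent_curve\<close>), so any function that vanishes on the feasible set has zero derivative along
tangents. Applied to \<open>A y - y\<close> this makes \<open>d \<mapsto> d v* P\<close> the identity on the tangent space, and
\<open>P J = 0\<close> makes it map into the tangent space: it is a projection onto it. In particular the kernel of
\<open>P\<close> is the range of \<open>J\<close>, so at a feasible point the gradient \<open>P *v grad f z\<close> of the penalty function
vanishes exactly when \<open>z\<close> is first-order stationary.

\<^bold>\<open>Feasibility of critical points.\<close> Let \<open>y\<close> be a critical point of the penalty function near \<open>x\<close> and
\<open>z\<close> a feasible point nearest to \<open>y\<close>. Then \<open>e = y - z\<close> lies in the range of \<open>J\<close>, which bounds
\<open>e v* J\<close>, and hence \<open>c y\<close>, below in terms of \<open>e\<close>. Testing the gradient against the
component \<open>u = e - e v* P\<close> along the kernel of the projection annihilates the gradient of \<open>f (A y)\<close>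
at \<open>z\<close>, so that this term is only \<open>O(norm e\<^sup>2)\<close> with the constant \<open>L_g\<close>, while the penalty
contributes \<open>\<beta>\<close> times a positive multiple of \<open>norm e\<^sup>2\<close>. For \<open>\<beta>\<close> beyond the threshold this forces
\<open>e = 0\<close> (\<open>critical_point_feasible\<close>).

\<^bold>\<open>Second order.\<close> At a feasible \<open>z\<close> with \<open>grad f z = J *v l\<close>, the Hessian form of the penalty function
in direction \<open>d\<close> is the sum of three terms (\<open>hess_penalty_feasible\<close>): the Lagrangian Hessian at the
tangent vector \<open>d v* P\<close>, the Hessian form of the function \<open>l \<bullet> c (A y)\<close> at \<open>d\<close>, and
\<open>\<beta> * (norm (d v* J))\<^sup>2\<close>. The gradient of \<open>l \<bullet> c (A y)\<close> vanishes on the feasible set, so its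
Hessian annihilates tangents. For tangent \<open>d\<close> only the Lagrangian term remains, which
shows that second-order stationarity of the penalty function is inherited by the constrained problem.
Conversely, by symmetry of that Hessian, the middle term depends only on the normal component of \<open>d\<close>; there it
is controlled by \<open>L_b\<close> and \<open>norm l\<close>, and the penalty term outweighs it
(\<open>dissolved_normal_curvature_bound\<close>).\<close>

section \<open>Gradients, Jacobians and second derivatives\<close>

lemma grad_has_derivative:
  assumes "f differentiable (at x)"
  shows "(f has_derivative (\<lambda>h. grad f x \<bullet> h)) (at x)"
proof -
  let ?D = "frechet_derivative f (at x)"
  have D: "(f has_derivative ?D) (at x)"
    using assms frechet_derivative_works by blast
  then have "linear ?D" by (rule has_derivative_linear)
  have "?D h = grad f x \<bullet> h" for h
  proof -
    have "?D h = ?D (\<Sum>i\<in>UNIV. (h $ i) *\<^sub>R axis i 1)"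
      using basis_expansion[of h] by (simp add: scalar_mult_eq_scaleR)
    also have "\<dots> = (\<Sum>i\<in>UNIV. (h $ i) * ?D (axis i 1))"
      using \<open>linear ?D\<close> by (simp add: linear_sum linear_cmul o_def)
    also have "\<dots> = grad f x \<bullet> h"
      by (simp add: grad_def inner_vec_def mult.commute)
    finally show ?thesis .
  qed
  with D show ?thesis by (metis (no_types, lifting) ext)
qed

lemma grad_eqI:
  assumes "(f has_derivative (\<lambda>h. G \<bullet> h)) (at x)"
  shows "grad f x = G"
proof -
  have "frechet_derivative f (at x) = (\<lambda>h. G \<bullet> h)"
    using assms frechet_derivative_at by metis
  then show ?thesis by (simp add: grad_def vec_eq_iff inner_axis)
qed

lemma trjac_has_derivative:
  assumes "F differentiable (at x)"
  shows "(F has_derivative (\<lambda>h. h v* trjac F x)) (at x)"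
  using assms unfolding jacobian_works trjac_def by simp

lemma grad_component:
  assumes "F differentiable (at x)"
  shows "grad (\<lambda>y. F y $ i) x = column i (trjac F x)"
proof (rule grad_eqI)
  have "((\<lambda>y. F y $ i) has_derivative (\<lambda>h. (h v* trjac F x) $ i)) (at x)"
    using bounded_linear.has_derivative[OF bounded_linear_vec_nth trjac_has_derivative[OF assms]] .
  moreover have "(h v* trjac F x) $ i = column i (trjac F x) \<bullet> h" for h
    by (simp add: vector_matrix_mult_def column_def inner_vec_def mult.commute)
  ultimately show "((\<lambda>y. F y $ i) has_derivative (\<lambda>h. column i (trjac F x) \<bullet> h)) (at x)"
    by simp
qed

lemma hess_mult:
  assumes "(grad f has_derivative H) (at x)"
  shows "hess f x *v d = H d"
proof -
  have "frechet_derivative (grad f) (at x) = H"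
    using assms frechet_derivative_at by metis
  moreover have "linear H" using assms by (rule has_derivative_linear)
  ultimately show ?thesis
    unfolding hess_def jacobian_def by simp
qed

lemma hess_mult_component:
  fixes c :: "real^'n \<Rightarrow> real^'p"
  assumes "\<And>y. c differentiable (at y)" "(trjac c has_derivative D) (at x)"
  shows "hess (\<lambda>y. c y $ i) x *v d = column i (D d)"
proof (rule hess_mult)
  have lin: "bounded_linear (\<lambda>M::real^'p^'n. column i M)"
    unfolding linear_conv_bounded_linear[symmetric]
    by (rule linearI) (simp_all add: column_def vec_eq_iff)
  have "grad (\<lambda>y. c y $ i) = (\<lambda>y. column i (trjac c y))"
    using grad_component assms(1) by blast
  then show "(grad (\<lambda>y. c y $ i) has_derivative (\<lambda>d. column i (D d))) (at x)"
    using bounded_linear.has_derivative[OF lin assms(2)] by simp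
qed

lemma inner_vector_matrix_mult:
  fixes w h :: "real^'a" and M :: "real^'a^'b"
  shows "w \<bullet> (v v* M) = (M *v w) \<bullet> v"
  using dot_lmul_matrix[of v M w] by (simp add: inner_commute)

lemma bounded_bilinear_matrix_vector_mult:
  "bounded_bilinear ((*v) :: real^'a^'b \<Rightarrow> real^'a \<Rightarrow> real^'b)"
  unfolding bilinear_conv_bounded_bilinear[symmetric] bilinear_def
  by (auto intro!: linearI simp: matrix_vector_mult_add_rdistrib matrix_vector_right_distrib
      scaleR_matrix_vector_assoc matrix_vector_mult_scaleR)

lemma bounded_bilinear_matrix_matrix_mult:
  "bounded_bilinear ((**) :: real^'a^'b \<Rightarrow> real^'c^'a \<Rightarrow> real^'c^'b)"
  unfolding bilinear_conv_bounded_bilinear[symmetric] bilinear_def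
  by (auto intro!: linearI simp: matrix_matrix_mult_def vec_eq_iff sum.distrib algebra_simps
      sum_distrib_left)

lemma column_sum_matrix_vector:
  fixes M :: "real^'p^'n"
  shows "(\<Sum>i\<in>UNIV. (l $ i) *\<^sub>R column i M) = M *v l"
  by (simp add: matrix_mult_sum scalar_mult_eq_scaleR)

text \<open>Only differentiability of the gradient at the single point \<open>x\<close> is available, so the classical argument
with continuous second partials does not apply. Instead the second difference over the parallelogram with
sides \<open>s *\<^sub>R u\<close> and \<open>s *\<^sub>R v\<close>, which is symmetric in \<open>u\<close> and \<open>v\<close>, equals
\<open>s\<^sup>2 * (H u \<bullet> v)\<close> up to \<open>o(s\<^sup>2)\<close> by the mean value theorem along \<open>v\<close>.\<close>

lemma second_derivative_symmetric:
  fixes G :: "'a::real_inner \<Rightarrow> 'a"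
  assumes \<phi>: "\<And>y. (\<phi> has_derivative (\<lambda>h. G y \<bullet> h)) (at y)"
    and G: "(G has_derivative H) (at x)"
  shows "H u \<bullet> v = H v \<bullet> u"
proof -
  have linH: "linear H" using G by (rule has_derivative_linear)
  define \<Delta> where "\<Delta> s u v = \<phi> (x + s *\<^sub>R u + s *\<^sub>R v) - \<phi> (x + s *\<^sub>R u) - \<phi> (x + s *\<^sub>R v) + \<phi> x"
    for s u v
  have "\<exists>r>0. \<forall>s. 0 < s \<and> s < r \<longrightarrow> \<bar>\<Delta> s u v - s\<^sup>2 * (H u \<bullet> v)\<bar> \<le> e * s\<^sup>2" if "e > 0" for e u v
  proof -
    define N where "N = norm u + norm v + 1"
    have N: "N > 0" "norm u \<le> N" "norm v \<le> N" "norm u + norm v \<le> N" by (simp_all add: N_def add_nonneg_pos)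
    define e' where "e' = e / (2 * N * N)"
    have "e' > 0" using that N by (simp add: e'_def)
    then obtain r where r: "r > 0"
      "\<And>y. norm (y - x) < r \<Longrightarrow> norm (G y - G x - H (y - x)) \<le> e' * norm (y - x)"
      using G unfolding has_derivative_at_alt by blast
    have "\<bar>\<Delta> s u v - s\<^sup>2 * (H u \<bullet> v)\<bar> \<le> e * s\<^sup>2" if s: "0 < s" "s < r / N" for s
    proof -
      \<comment> \<open>The second difference is the increment over \<open>[0, s]\<close> of the first difference in direction \<open>u\<close>.\<close>
      define \<psi> where "\<psi> \<tau> = \<phi> (x + \<tau> *\<^sub>R v + s *\<^sub>R u) - \<phi> (x + \<tau> *\<^sub>R v)" for \<tau>
      have "(\<psi> has_derivative (\<lambda>k. G (x + \<tau> *\<^sub>R v + s *\<^sub>R u) \<bullet> (k *\<^sub>R v) - G (x + \<tau> *\<^sub>R v) \<bullet> (k *\<^sub>R v)))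
          (at \<tau> within {0..s})" for \<tau>
        unfolding \<psi>_def
        by (rule has_derivative_at_withinI)
          (auto intro!: derivative_eq_intros has_derivative_compose[OF _ \<phi>])
      from mvt_simple[OF s(1), of \<psi>, OF this]
      obtain \<tau> where \<tau>: "0 < \<tau>" "\<tau> < s"
        and eq: "\<psi> s - \<psi> 0 = s * ((G (x + \<tau> *\<^sub>R v + s *\<^sub>R u) - G (x + \<tau> *\<^sub>R v)) \<bullet> v)"
        by (auto simp: inner_diff_left algebra_simps)
      have \<Delta>: "\<Delta> s u v = \<psi> s - \<psi> 0"
        by (simp add: \<Delta>_def \<psi>_def algebra_simps)
      define p where "p = \<tau> *\<^sub>R v + s *\<^sub>R u"
      define q where "q = \<tau> *\<^sub>R v"
      have np: "norm p \<le> s * N"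
      proof -
        have "norm p \<le> \<tau> * norm v + s * norm u"
          unfolding p_def using \<tau> s norm_triangle_ineq[of "\<tau> *\<^sub>R v" "s *\<^sub>R u"] by simp
        also have "\<dots> \<le> s * norm v + s * norm u" using \<tau> by (simp add: mult_right_mono)
        also have "\<dots> = s * (norm u + norm v)" by (simp add: algebra_simps)
        also have "\<dots> \<le> s * N" using N s by (intro mult_left_mono) auto
        finally show ?thesis .
      qed
      have nq: "norm q \<le> s * N"
        unfolding q_def using \<tau> s N by (auto intro!: mult_mono)
      have sN: "s * N < r" using s N by (simp add: field_simps)
      have e1: "norm (G (x + p) - G x - H p) \<le> e' * (s * N)"
        using r(2)[of "x + p"] np sN \<open>e' > 0\<close> by (smt (verit) add_diff_cancel_left' mult_left_mono)
      have e2: "norm (G (x + q) - G x - H q) \<le> e' * (s * N)"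
        using r(2)[of "x + q"] nq sN \<open>e' > 0\<close> by (smt (verit) add_diff_cancel_left' mult_left_mono)
      have Hpq: "H p - H q = s *\<^sub>R H u"
        unfolding p_def q_def using linH by (simp add: linear_add linear_cmul)
      have "norm (G (x + p) - G (x + q) - s *\<^sub>R H u) \<le> 2 * (e' * (s * N))"
      proof -
        have "G (x + p) - G (x + q) - s *\<^sub>R H u = (G (x + p) - G x - H p) - (G (x + q) - G x - H q)"
          unfolding Hpq[symmetric] by simp
        then show ?thesis using e1 e2 norm_triangle_ineq4 by (smt (verit))
      qed
      then have b: "\<bar>(G (x + p) - G (x + q) - s *\<^sub>R H u) \<bullet> v\<bar> \<le> 2 * (e' * (s * N)) * N"
        using Cauchy_Schwarz_ineq2[of "G (x + p) - G (x + q) - s *\<^sub>R H u" v] N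
        by (smt (verit) mult_mono norm_ge_zero)
      have "\<Delta> s u v - s\<^sup>2 * (H u \<bullet> v) = s * ((G (x + p) - G (x + q) - s *\<^sub>R H u) \<bullet> v)"
        unfolding \<Delta> eq p_def q_def by (simp add: inner_diff_left algebra_simps power2_eq_square)
      also have "\<bar>\<dots>\<bar> \<le> s * (2 * (e' * (s * N)) * N)"
        using b s by (simp add: abs_mult)
      also have "\<dots> = e * s\<^sup>2" using N by (simp add: e'_def power2_eq_square field_simps)
      finally show ?thesis .
    qed
    moreover have "r / N > 0" using r N by simp
    ultimately show ?thesis by blast
  qed note key = this
  have sym: "\<Delta> s u v = \<Delta> s v u" for s u v by (simp add: \<Delta>_def algebra_simps)
  have "\<bar>H u \<bullet> v - H v \<bullet> u\<bar> \<le> e" if e: "e > 0" for e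
  proof -
    obtain r1 where r1: "r1 > 0" "\<And>s. 0 < s \<Longrightarrow> s < r1 \<Longrightarrow> \<bar>\<Delta> s u v - s\<^sup>2 * (H u \<bullet> v)\<bar> \<le> e/2 * s\<^sup>2"
      using key[OF half_gt_zero[OF e], of u v] by blast
    obtain r2 where r2: "r2 > 0" "\<And>s. 0 < s \<Longrightarrow> s < r2 \<Longrightarrow> \<bar>\<Delta> s v u - s\<^sup>2 * (H v \<bullet> u)\<bar> \<le> e/2 * s\<^sup>2"
      using key[OF half_gt_zero[OF e], of v u] by blast
    define s where "s = min r1 r2 / 2"
    have s: "0 < s" "s < r1" "s < r2" using r1 r2 by (auto simp: s_def)
    have "\<bar>s\<^sup>2 * (H u \<bullet> v) - s\<^sup>2 * (H v \<bullet> u)\<bar> \<le> e * s\<^sup>2"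
      using r1(2)[OF s(1,2)] r2(2)[OF s(1,3)] sym[of s u v] by linarith
    moreover have "\<bar>s\<^sup>2 * (H u \<bullet> v) - s\<^sup>2 * (H v \<bullet> u)\<bar> = s\<^sup>2 * \<bar>H u \<bullet> v - H v \<bullet> u\<bar>"
      unfolding right_diff_distrib[symmetric] by (simp add: abs_mult)
    ultimately have "s\<^sup>2 * \<bar>H u \<bullet> v - H v \<bullet> u\<bar> \<le> s\<^sup>2 * e"
      by (simp add: mult.commute)
    then show ?thesis using s by simp
  qed
  then show ?thesis
    by (metis eq_iff_diff_eq_0 abs_le_zero_iff dense_ge)
qed

lemma derivative_bounded_by_lipschitz:
  fixes F :: "'a::real_normed_vector \<Rightarrow> 'b::real_normed_vector"
  assumes F: "(F has_derivative D) (at z)" and "r > 0" "K \<ge> 0"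
    and lip: "\<And>y. norm (y - z) < r \<Longrightarrow> norm (F y - F z) \<le> K * norm (y - z)"
  shows "norm (D u) \<le> K * norm u"
proof -
  have linD: "linear D" using F by (rule has_derivative_linear)
  have "norm (D u) \<le> (K + e) * norm u" if "e > 0" for e
  proof (cases "u = 0")
    case True then show ?thesis using linD by (simp add: linear_0)
  next
    case False
    obtain q where q: "q > 0" "\<And>y. norm (y - z) < q \<Longrightarrow> norm (F y - F z - D (y - z)) \<le> e * norm (y - z)"
      using F \<open>e > 0\<close> unfolding has_derivative_at_alt by blast
    define s where "s = min r q / (2 * norm u)"
    have s: "s > 0" "s * norm u < r" "s * norm u < q"
      using False q(1) \<open>r > 0\<close> by (auto simp: s_def min_def)
    have "norm (D (s *\<^sub>R u)) \<le> norm (F (z + s *\<^sub>R u) - F z) + norm (F (z + s *\<^sub>R u) - F z - D (s *\<^sub>R u))"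
      by (metis norm_triangle_sub norm_minus_commute add.commute)
    also have "\<dots> \<le> K * (s * norm u) + e * (s * norm u)"
      using lip[of "z + s *\<^sub>R u"] q(2)[of "z + s *\<^sub>R u"] s by simp
    finally have "s * norm (D u) \<le> s * ((K + e) * norm u)"
      using linD s by (simp add: linear_cmul algebra_simps)
    then show ?thesis using s by simp
  qed note key = this
  show ?thesis
  proof (rule field_le_epsilon)
    fix e :: real assume "e > 0"
    define d where "d = e / (norm u + 1)"
    have "d > 0" using \<open>e > 0\<close> by (simp add: d_def add_nonneg_pos)
    have "d * norm u \<le> d * (norm u + 1)" using \<open>d > 0\<close> by (intro mult_left_mono) auto
    also have "\<dots> = e" by (simp add: d_def add_nonneg_eq_0_iff)
    finally have "d * norm u \<le> e" .
    then show "norm (D u) \<le> K * norm u + e" using key[OF \<open>d > 0\<close>] by (simp add: algebra_simps)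
  qed
qed

section \<open>Operator norm and smallest singular value\<close>

lemma norm_matrix_vector_mult_le: "norm (M *v v) \<le> opnorm M * norm v"
  unfolding opnorm_def by (rule onorm[OF matrix_vector_mul_bounded_linear])

lemma opnorm_nonneg: "opnorm M \<ge> 0"
  unfolding opnorm_def by (rule onorm_pos_le[OF matrix_vector_mul_bounded_linear])

lemma opnorm_zero [simp]: "opnorm (0 :: real^'n^'m) = 0"
proof -
  have "((*v) (0 :: real^'n^'m)) = (\<lambda>_. 0)" by auto
  then show "opnorm (0 :: real^'n^'m) = 0" by (simp add: opnorm_def onorm_zero)
qed

lemma norm_vector_matrix_mult_le:
  fixes M :: "real^'m^'n"
  shows "norm (v v* M) \<le> opnorm M * norm v"
proof -
  have "(norm (v v* M))\<^sup>2 = v \<bullet> (M *v (v v* M))"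
    by (simp add: power2_norm_eq_inner dot_lmul_matrix)
  also have "\<dots> \<le> norm v * (opnorm M * norm (v v* M))"
    by (meson Cauchy_Schwarz_ineq2 norm_matrix_vector_mult_le abs_le_D1 mult_left_mono norm_ge_zero order_trans)
  finally have "norm (v v* M) * norm (v v* M) \<le> (opnorm M * norm v) * norm (v v* M)"
    by (simp add: power2_eq_square mult_ac)
  then show ?thesis
    using opnorm_nonneg[of M] by (metis mult_le_cancel_right_pos mult_nonneg_nonneg norm_ge_zero order_le_less)
qed

lemma opnorm_le_norm:
  obtains K where "K > 0" "\<And>M :: real^'m^'n. opnorm M \<le> K * norm M"
proof -
  obtain K where K: "K > 0" "\<And>(M :: real^'m^'n) v. norm (M *v v) \<le> norm M * norm v * K"
    using bounded_bilinear.pos_bounded[OF bounded_bilinear_matrix_vector_mult] by blast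
  have "opnorm M \<le> K * norm M" for M :: "real^'m^'n"
    unfolding opnorm_def by (rule onorm_le) (use K(2) in \<open>simp add: mult_ac\<close>)
  with K(1) that show ?thesis by blast
qed

text \<open>A minimiser \<open>v\<close> of \<open>norm (M *v v)\<close> on the unit sphere is an eigenvector of \<open>transpose M ** M\<close> by
stationarity, so the minimum is a singular value; and every singular value dominates
the minimum. This replaces the eigenvalue definition by the variational one.\<close>

lemma sigma_min_attained:
  fixes M :: "real^'p^'n"
  obtains v where "norm v = 1" "norm (M *v v) = sigma_min M"
    and "\<And>w. sigma_min M * norm w \<le> norm (M *v w)"
proof -
  have cont: "continuous_on (sphere 0 1) (\<lambda>v. norm (M *v v))"
    by (intro continuous_intros)
  have ne: "sphere (0::real^'p) 1 \<noteq> {}" by simp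
  obtain v where v: "norm v = 1" "\<And>w. norm w = 1 \<Longrightarrow> norm (M *v v) \<le> norm (M *v w)"
    using continuous_attains_inf[OF compact_sphere ne cont] by auto
  define s where "s = norm (M *v v)"
  have le: "s * norm w \<le> norm (M *v w)" for w
  proof (cases "w = 0")
    case False
    then have "s \<le> norm (M *v ((1 / norm w) *\<^sub>R w))" unfolding s_def by (intro v(2)) simp
    also have "\<dots> = norm (M *v w) / norm w" by (simp add: matrix_vector_mult_scaleR)
    finally show ?thesis using False by (simp add: field_simps)
  qed simp
  define G where "G = transpose M ** M"
  have G: "x \<bullet> (G *v y) = (M *v x) \<bullet> (M *v y)" for x y
    unfolding G_def matrix_vector_mul_assoc[symmetric]
    by (metis dot_lmul_matrix inner_commute transpose_matrix_vector)
  have eig: "G *v v = s\<^sup>2 *s v"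
  proof -
    \<comment> \<open>If the eigenvalue residual \<open>w\<close> were nonzero, a small step along \<open>- w\<close> would
  violate the lower bound \<open>le\<close>.\<close>
    define w where "w = G *v v - s\<^sup>2 *\<^sub>R v"
    define a where "a = w \<bullet> w"
    define b where "b = w \<bullet> (G *v w) - s\<^sup>2 * (w \<bullet> w)"
    have quad: "2 * t * a + t\<^sup>2 * b \<ge> 0" for t
    proof -
      have "s\<^sup>2 * (norm (v + t *\<^sub>R w))\<^sup>2 \<le> (norm (M *v (v + t *\<^sub>R w)))\<^sup>2"
        using le[of "v + t *\<^sub>R w"] power_mono[of "s * norm (v + t *\<^sub>R w)" _ 2]
        by (simp add: power_mult_distrib s_def)
      moreover have "v \<bullet> v = 1" using v(1) by (simp add: norm_eq_1)
      moreover have "(M *v v) \<bullet> (M *v v) = s\<^sup>2" by (simp add: s_def power2_norm_eq_inner)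
      moreover have "w \<bullet> (G *v v) = a + s\<^sup>2 * (w \<bullet> v)"
        unfolding a_def by (subst (2) w_def) (simp add: inner_diff_right)
      ultimately show ?thesis
        unfolding power2_norm_eq_inner matrix_vector_right_distrib matrix_vector_mult_scaleR
        unfolding b_def
        by (simp add: inner_add_left inner_add_right G inner_commute algebra_simps power2_eq_square
              a_def)
    qed
    have "a = 0"
    proof (rule ccontr)
      assume "a \<noteq> 0"
      then have "a > 0" by (simp add: a_def)
      \<comment> \<open>Small enough that the quadratic term at most cancels half of the linear one.\<close>
      define t where "t = - a / (\<bar>b\<bar> + 1)"
      have "t < 0" using \<open>a > 0\<close> by (simp add: t_def divide_neg_pos)
      have "t\<^sup>2 * b \<le> t\<^sup>2 * (\<bar>b\<bar> + 1)" by (intro mult_left_mono) auto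
      also have "\<dots> = - t * a" by (simp add: t_def power2_eq_square)
      finally have "2 * t * a + t\<^sup>2 * b \<le> t * a" by (simp only: mult.assoc mult_2 mult_minus_left distrib_right)
      also have "t * a < 0" using \<open>t < 0\<close> \<open>a > 0\<close> by (simp add: mult_neg_pos)
      finally show False using quad[of t] by simp
    qed
    then show ?thesis by (simp add: a_def w_def scalar_mult_eq_scaleR)
  qed
  have "sigma_min M = s"
    unfolding sigma_min_def
  proof (rule Least_equality)
    show "singular_value M s"
      unfolding singular_value_def G_def[symmetric]
      using eig v(1) by (intro conjI exI[of _ v]) (auto simp: s_def)
  next
    fix r assume "singular_value M r"
    then obtain w where r: "r \<ge> 0" "w \<noteq> 0" "G *v w = r\<^sup>2 *s w"
      unfolding singular_value_def G_def by blast
    have "(norm (M *v w))\<^sup>2 = (r * norm w)\<^sup>2"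
      using G[of w w] r(3) by (simp add: power2_norm_eq_inner power_mult_distrib scalar_mult_eq_scaleR)
    then have "norm (M *v w) = r * norm w" using r(1) by (simp add: power2_eq_iff_nonneg)
    then show "s \<le> r" using le[of w] r(2) by simp
  qed
  with le v(1) that show ?thesis by (simp add: s_def)
qed

lemma sigma_min_le: "sigma_min M * norm w \<le> norm (M *v w)"
  using sigma_min_attained by blast

lemma sigma_min_nonneg: "sigma_min M \<ge> 0"
  using sigma_min_attained[of M] by (metis norm_ge_zero)

lemma sigma_min_pos:
  assumes "inj ((*v) M)"
  shows "sigma_min M > 0"
proof -
  obtain v where v: "norm v = 1" "norm (M *v v) = sigma_min M" using sigma_min_attained by blast
  have "M *v v \<noteq> 0" using assms v(1) by (metis injD matrix_vector_mult_0_right norm_zero zero_neq_one)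
  then show ?thesis using v(2) by (metis zero_less_norm_iff)
qed

text \<open>The transpose vanishes on the orthogonal complement of the range of \<open>M\<close>; on the range itself
the bound comes from pairing \<open>(M *v v) v* M\<close> with \<open>v\<close>.\<close>

lemma sigma_min_le_transpose:
  "sigma_min M * norm (M *v v) \<le> norm ((M *v v) v* M)"
proof (cases "M *v v = 0")
  case False
  have "norm (M *v v) * (sigma_min M * norm v) \<le> norm (M *v v) * norm (M *v v)"
    using sigma_min_le[of M v] by (intro mult_left_mono) auto
  also have "\<dots> = ((M *v v) v* M) \<bullet> v"
    by (simp add: dot_lmul_matrix power2_norm_eq_inner[symmetric] power2_eq_square)
  also have "\<dots> \<le> norm ((M *v v) v* M) * norm v" by (rule norm_cauchy_schwarz)
  finally have "norm v * (sigma_min M * norm (M *v v)) \<le> norm v * norm ((M *v v) v* M)"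
    by (simp add: mult_ac)
  moreover have "norm v > 0" using False by auto
  ultimately show ?thesis by simp
qed simp

lemma sigma_min_diff_le: "sigma_min M \<le> sigma_min N + opnorm (M - N)"
proof -
  obtain v where v: "norm v = 1" "norm (N *v v) = sigma_min N" using sigma_min_attained by blast
  have "sigma_min M \<le> norm (M *v v)" using sigma_min_le[of M v] v by simp
  also have "\<dots> \<le> norm (N *v v) + norm ((M - N) *v v)"
    by (metis matrix_vector_mult_diff_rdistrib norm_triangle_sub)
  also have "\<dots> \<le> sigma_min N + opnorm (M - N)"
    using norm_matrix_vector_mult_le[of "M - N" v] v by simp
  finally show ?thesis .
qed

lemma continuous_on_sigma_min: "continuous_on UNIV (sigma_min :: real^'p^'n \<Rightarrow> real)"
proof -
  obtain K where K: "K > 0" "\<And>M :: real^'p^'n. opnorm M \<le> K * norm M" using opnorm_le_norm by blast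
  have "\<bar>sigma_min M - sigma_min N\<bar> \<le> K * norm (M - N)" for M N :: "real^'p^'n"
    using sigma_min_diff_le[of M N] sigma_min_diff_le[of N M] K(2)[of "M - N"] K(2)[of "N - M"]
    by (simp add: norm_minus_commute)
  then have "K-lipschitz_on UNIV (sigma_min :: real^'p^'n \<Rightarrow> real)"
    using K(1) by (intro lipschitz_onI) (auto simp: dist_norm)
  then show ?thesis by (rule lipschitz_on_continuous_on)
qed

section \<open>Lipschitz constants on compact sets\<close>

lemma locally_lipschitz_on_compact:
  assumes "locally_lipschitz F" "compact S"
  obtains L where "L-lipschitz_on S F"
proof -
  have "local_lipschitz {0::real} S (\<lambda>_. F)"
  proof (rule local_lipschitzI)
    fix t :: real and x assume "x \<in> S"
    obtain r L where "r > 0" "L-lipschitz_on (cball x r) F"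
      using assms(1) unfolding locally_lipschitz_def by blast
    then show "\<exists>u>0. \<exists>L. \<forall>s\<in>cball t u \<inter> {0}. L-lipschitz_on (cball x u \<inter> S) F"
      by (meson Int_lower1 lipschitz_on_subset)
  qed
  then obtain L where "\<And>t. t \<in> {0::real} \<Longrightarrow> L-lipschitz_on S F"
    using local_lipschitz_compact_implies_lipschitz[OF _ assms(2), of "{0::real}" "\<lambda>_. F"]
    \<open>local_lipschitz {0} S (\<lambda>_. F)\<close> by auto
  then show ?thesis using that by blast
qed

lemma locally_lipschitz_continuous_on:
  assumes "locally_lipschitz F"
  shows "continuous_on UNIV F"
proof -
  have "isCont F x" for x
  proof -
    obtain r L where r: "r > 0" "L-lipschitz_on (cball x r) F"
      using assms unfolding locally_lipschitz_def by blast
    then have "continuous_on (ball x r) F"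
      by (meson ball_subset_cball continuous_on_subset lipschitz_on_continuous_on)
    then show ?thesis using r(1) by (simp add: continuous_on_eq_continuous_at)
  qed
  then show ?thesis by (simp add: continuous_at_imp_continuous_on)
qed

lemma lipschitz_on_bounded_bilinear:
  assumes b: "bounded_bilinear b" and S: "compact S"
    and F: "K-lipschitz_on S F" and G: "L-lipschitz_on S G"
  obtains N where "N-lipschitz_on S (\<lambda>x. b (F x) (G x))"
proof -
  interpret bounded_bilinear b by (rule b)
  obtain B where B: "B > 0" "\<And>x y. norm (b x y) \<le> norm x * norm y * B" using pos_bounded by blast
  have "compact (F ` S)" "compact (G ` S)"
    using S F G by (auto intro: compact_continuous_image lipschitz_on_continuous_on)
  then obtain P Q where P: "P > 0" "\<And>x. x \<in> S \<Longrightarrow> norm (F x) \<le> P"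
    and Q: "Q > 0" "\<And>x. x \<in> S \<Longrightarrow> norm (G x) \<le> Q"
    by (metis compact_imp_bounded bounded_pos imageI)
  have KL: "K \<ge> 0" "L \<ge> 0" using F G lipschitz_on_nonneg by auto
  have "((K * Q + P * L) * B)-lipschitz_on S (\<lambda>x. b (F x) (G x))"
  proof (rule lipschitz_onI)
    fix x y assume xy: "x \<in> S" "y \<in> S"
    have "b (F x) (G x) - b (F y) (G y) = b (F x - F y) (G x) + b (F y) (G x - G y)"
      by (simp add: diff_left diff_right)
    then have "norm (b (F x) (G x) - b (F y) (G y))
        \<le> norm (b (F x - F y) (G x)) + norm (b (F y) (G x - G y))"
      by (simp add: norm_triangle_ineq)
    also have "\<dots> \<le> norm (F x - F y) * norm (G x) * B + norm (F y) * norm (G x - G y) * B"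
      by (intro add_mono B(2))
    also have "\<dots> \<le> (K * dist x y) * Q * B + P * (L * dist x y) * B"
      using B(1) P(2)[OF xy(2)] Q(2)[OF xy(1)] KL
        lipschitz_onD[OF F xy] lipschitz_onD[OF G xy] P(1) Q(1)
      by (intro add_mono mult_right_mono mult_mono) (auto simp: dist_norm)
    finally show "dist (b (F x) (G x)) (b (F y) (G y)) \<le> (K * Q + P * L) * B * dist x y"
      by (simp add: dist_norm algebra_simps)
  qed (use KL B(1) P(1) Q(1) in auto)
  then show ?thesis using that by blast
qed

text \<open>\<open>lip_const\<close> is a supremum of reals, meaningful only for bounded families of difference
quotients; any Lipschitz bound provides this.\<close>

lemma lip_constD:
  fixes N :: "'b::ab_group_add \<Rightarrow> real"
  assumes "\<And>y z. y \<in> S \<Longrightarrow> z \<in> S \<Longrightarrow> N (F y - F z) \<le> L * norm (y - z)"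
    and "N 0 = 0" "y \<in> S" "z \<in> S"
  shows "N (F y - F z) \<le> lip_const N S F * norm (y - z)"
proof (cases "y = z")
  case False
  have "bdd_above ((\<lambda>(y, z). N (F y - F z) / norm (y - z)) ` {(y, z). y \<in> S \<and> z \<in> S \<and> y \<noteq> z})"
    using assms(1) by (intro bdd_aboveI[of _ L]) (auto simp: field_simps)
  then have "(\<lambda>(y, z). N (F y - F z) / norm (y - z)) (y, z) \<le> lip_const N S F"
    unfolding lip_const_def using False assms(3,4) by (intro cSUP_upper) auto
  then show ?thesis using False by (simp add: field_simps)
qed (use assms(2) in simp)

lemma lip_const_norm:
  fixes F :: "'a::real_normed_vector \<Rightarrow> 'b::real_normed_vector"
  assumes "L-lipschitz_on S F" "y \<in> S" "z \<in> S"
  shows "norm (F y - F z) \<le> lip_const norm S F * norm (y - z)"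
  using lipschitz_on_normD[OF assms(1)] assms(2,3) by (intro lip_constD) auto

lemma lip_const_opnorm:
  fixes F :: "'a::real_normed_vector \<Rightarrow> real^'m^'n"
  assumes L: "L-lipschitz_on S F" and "y \<in> S" "z \<in> S"
  shows "opnorm (F y - F z) \<le> lip_const opnorm S F * norm (y - z)"
proof -
  obtain K where K: "K > 0" "\<And>M :: real^'m^'n. opnorm M \<le> K * norm M" using opnorm_le_norm by blast
  have "opnorm (F u - F v) \<le> (K * L) * norm (u - v)" if "u \<in> S" "v \<in> S" for u v
    using lipschitz_on_normD[OF L that] K(1)
    by (intro order_trans[OF K(2)]) (simp add: mult.assoc)
  then show ?thesis using assms(2,3) by (intro lip_constD) auto
qed

section \<open>Geometry of a regular level set\<close>

text \<open>The Gram matrix \<open>transpose J ** J\<close> of an injective \<open>J\<close> is invertible. It serves to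
solve for normal displacements and to split off normal components.\<close>

lemma regular_point_gram_inverse:
  fixes J :: "real^'p^'n"
  assumes "inj ((*v) J)"
  obtains g where "linear g" "\<And>v. g ((J *v v) v* J) = v" "\<And>q. (J *v g q) v* J = q"
proof -
  define G where "G v = (J *v v) v* J" for v
  have G: "G = (\<lambda>v. (transpose J ** J) *v v)"
    by (simp add: fun_eq_iff G_def matrix_vector_mul_assoc[symmetric])
  have lin: "linear G" unfolding G by (rule matrix_vector_mul_linear)
  have inj: "inj G"
  proof (rule linear_injective_0[OF lin, THEN iffD2], intro allI impI)
    fix v assume "G v = 0"
    then have "(J *v v) \<bullet> (J *v v) = 0" by (simp add: G_def dot_lmul_matrix[symmetric])
    then have "J *v v = J *v 0" by simp
    then show "v = 0" using assms injD by metis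
  qed
  obtain g where g: "linear g" "g \<circ> G = id"
    using linear_injective_left_inverse[OF lin inj] by blast
  have "surj G" using linear_injective_imp_surjective[OF lin inj] by simp
  then have "G (g q) = q" for q using g(2) by (metis comp_apply id_apply surjD)
  with g that show ?thesis by (metis G_def comp_apply id_apply)
qed

lemma tangent_normal_decomposition:
  fixes J :: "real^'p^'n"
  assumes "inj ((*v) J)"
  obtains v where "(d - J *v v) v* J = 0"
  by (metis regular_point_gram_inverse[OF assms] vector_matrix_mult_diff_distrib diff_self
)

lemma normal_in_range:
  fixes J :: "real^'p^'n"
  assumes "inj ((*v) J)" and "\<And>t. t v* J = 0 \<Longrightarrow> t \<bullet> w = 0"
  obtains v where "w = J *v v"
proof -
  obtain v where v: "(w - J *v v) v* J = 0" using tangent_normal_decomposition[OF assms(1)] by blast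
  have "(w - J *v v) \<bullet> (J *v v) = 0" using v by (simp add: dot_lmul_matrix[symmetric])
  moreover have "(w - J *v v) \<bullet> w = 0" using assms(2) v by blast
  ultimately have "(w - J *v v) \<bullet> (w - J *v v) = 0" by (simp add: inner_diff_right)
  then show ?thesis using that by simp
qed

text \<open>Correct the point \<open>z + s *\<^sub>R t\<close> by a normal displacement \<open>J *v u\<close>. To first order the constraint is
\<open>(J *v u) v* J\<close>, so a zero is a fixed point of \<open>u - g (c (z + s *\<^sub>R t + J *v u))\<close>, with \<open>g\<close> the
inverse of the Gram map. Differentiability at \<open>z\<close> alone makes this map a ball of radius \<open>o(s)\<close> to itself,
and Brouwer's theorem applies.\<close>

lemma zero_near_tangent_line:
  fixes c :: "real^'n \<Rightarrow> real^'p" and J :: "real^'p^'n"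
  assumes c: "continuous_on UNIV c" "c z = 0" "(c has_derivative (\<lambda>h. h v* J)) (at z)"
    and inj: "inj ((*v) J)" and t: "t v* J = 0" and "\<delta> > 0"
  obtains r where "r > 0"
    "\<And>s. 0 < s \<Longrightarrow> s < r \<Longrightarrow> \<exists>y. c y = 0 \<and> norm (y - (z + s *\<^sub>R t)) \<le> \<delta> * s"
proof -
  obtain g where g: "linear g" "\<And>v. g ((J *v v) v* J) = v" "\<And>q. (J *v g q) v* J = q"
    using regular_point_gram_inverse[OF inj] by blast
  obtain K where K: "K > 0" "\<And>q. norm (g q) \<le> K * norm q"
    using linear_bounded_pos[OF g(1)] by blast
  obtain N where N: "N > 0" "\<And>v. norm (J *v v) \<le> N * norm v"
    using linear_bounded_pos[OF matrix_vector_mul_linear] by blast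
  define T where "T = norm t + \<delta>"
  have T: "T > 0" using \<open>\<delta> > 0\<close> by (simp add: T_def add_nonneg_pos)
  define \<eta> where "\<eta> = \<delta> / N"
  have \<eta>: "\<eta> > 0" using \<open>\<delta> > 0\<close> N by (simp add: \<eta>_def)
  \<comment> \<open>The linearization error that keeps the map below within the ball of radius \<open>\<eta> * s\<close>, since
  displacements have norm at most \<open>s * T\<close>.\<close>
  define e where "e = \<eta> / (K * T)"
  have "e > 0" using \<eta> K T by (simp add: e_def)
  then obtain q where q: "q > 0"
    "\<And>y. norm (y - z) < q \<Longrightarrow> norm (c y - c z - (y - z) v* J) \<le> e * norm (y - z)"
    using c(3) unfolding has_derivative_at_alt by blast
  have "\<exists>y. c y = 0 \<and> norm (y - (z + s *\<^sub>R t)) \<le> \<delta> * s" if s: "0 < s" "s < q / T" for s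
  proof -
    define Y where "Y u = z + (s *\<^sub>R t + J *v u)" for u
    define \<Phi> where "\<Phi> u = u - g (c (Y u))" for u
    have JB: "norm (J *v u) \<le> \<delta> * s" if "norm u \<le> \<eta> * s" for u
    proof -
      have "norm (J *v u) \<le> N * (\<eta> * s)" using N that by (meson mult_left_mono order_trans less_imp_le)
      then show ?thesis using N by (simp add: \<eta>_def)
    qed
    have bound: "norm (\<Phi> u) \<le> \<eta> * s" if u: "norm u \<le> \<eta> * s" for u
    proof -
      define h where "h = s *\<^sub>R t + J *v u"
      have "norm h \<le> s * norm t + \<delta> * s"
        unfolding h_def using JB[OF u] s norm_triangle_ineq[of "s *\<^sub>R t" "J *v u"] by simp
      then have nh: "norm h \<le> s * T" by (simp add: T_def algebra_simps)
      moreover have "s * T < q" using s T by (simp add: field_simps)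
      ultimately have "norm (c (z + h) - c z - h v* J) \<le> e * norm h" using q(2)[of "z + h"] by simp
      also have "\<dots> \<le> e * (s * T)" using nh \<open>e > 0\<close> by simp
      finally have err: "norm (c (Y u) - h v* J) \<le> e * (s * T)" using c(2) by (simp add: Y_def h_def)
      have "h v* J = (J *v u) v* J"
        unfolding h_def using t by (simp add: vector_matrix_left_distrib scaleR_vector_matrix_assoc)
      then have "u = g (h v* J)" using g(2) by simp
      then have "\<Phi> u = - g (c (Y u) - h v* J)" using g(1) by (simp add: \<Phi>_def linear_diff)
      then have "norm (\<Phi> u) \<le> K * (e * (s * T))"
        using K err by (metis norm_minus_cancel mult_left_mono order_trans less_imp_le)
      also have "\<dots> = \<eta> * s" using K T by (simp add: e_def)
      finally show ?thesis .
    qed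
    have contY: "continuous_on UNIV Y" unfolding Y_def by (intro continuous_intros)
    have "continuous_on UNIV (\<lambda>u. c (Y u))"
      using continuous_on_compose2[OF c(1) contY] by simp
    then have "continuous_on UNIV (\<lambda>u. g (c (Y u)))"
      using linear_continuous_on_compose[OF _ g(1)] by blast
    then have "continuous_on (cball 0 (\<eta> * s)) \<Phi>"
      unfolding \<Phi>_def by (intro continuous_intros) (blast intro: continuous_on_subset)
    moreover have "\<Phi> \<in> cball 0 (\<eta> * s) \<rightarrow> cball 0 (\<eta> * s)" using bound by auto
    moreover have "cball (0::real^'p) (\<eta> * s) \<noteq> {}" using mult_pos_pos[OF \<eta> s(1)] by simp
    ultimately obtain u where u: "u \<in> cball 0 (\<eta> * s)" "\<Phi> u = u"
      using brouwer[of "cball 0 (\<eta> * s)" \<Phi>] by (metis compact_cball convex_cball)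
    have "g (c (Y u)) = 0" using u(2) by (simp add: \<Phi>_def)
    then have "c (Y u) = 0" using g(3)[of "c (Y u)"] by simp
    moreover have "norm (Y u - (z + s *\<^sub>R t)) \<le> \<delta> * s" using JB[of u] u(1) by (simp add: Y_def)
    ultimately show ?thesis by blast
  qed
  moreover have "q / T > 0" using q T by simp
  ultimately show ?thesis using that by blast
qed

text \<open>The nearest feasible point to \<open>z + s *\<^sub>R t\<close> is a canonical choice whose distance is \<open>o(s)\<close>, because some
zero is that close for every prescribed accuracy.\<close>

lemma tangent_curve:
  fixes c :: "real^'n \<Rightarrow> real^'p" and J :: "real^'p^'n"
  assumes c: "continuous_on UNIV c" "c z = 0" "(c has_derivative (\<lambda>h. h v* J)) (at z)"
    and inj: "inj ((*v) J)" and t: "t v* J = 0"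
  obtains y where "y 0 = z" "\<And>s. c (y s) = 0" "(y has_vector_derivative t) (at 0 within {0..})"
proof -
  define S where "S = {y. c y = 0}"
  have S: "closed S" "S \<noteq> {}"
    using c(2) continuous_closed_preimage_constant[OF c(1) closed_UNIV, of 0] by (auto simp: S_def)
  define y where "y s = closest_point S (z + s *\<^sub>R t)" for s
  have y: "c (y s) = 0" for s
    using closest_point_in_set[OF S] by (simp add: y_def S_def)
  have near: "norm (y s - (z + s *\<^sub>R t)) \<le> norm (w - (z + s *\<^sub>R t))" if "c w = 0" for s w
    using closest_point_exists(2)[OF S, of "z + s *\<^sub>R t"] that
    by (simp add: y_def S_def dist_norm norm_minus_commute)
  have y0: "y 0 = z" using near[of z 0] c(2) by simp
  have "(y has_derivative (\<lambda>s. s *\<^sub>R t)) (at 0 within {0..})"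
    unfolding has_derivative_within_alt
  proof (intro conjI allI impI)
    show "bounded_linear (\<lambda>s. s *\<^sub>R t)" by (rule bounded_linear_scaleR_left)
    fix e :: real assume "e > 0"
    obtain r where r: "r > 0"
      "\<And>s. 0 < s \<Longrightarrow> s < r \<Longrightarrow> \<exists>y. c y = 0 \<and> norm (y - (z + s *\<^sub>R t)) \<le> e * s"
      using zero_near_tangent_line[OF c inj t \<open>e > 0\<close>] by blast
    have "norm (y s - y 0 - (s - 0) *\<^sub>R t) \<le> e * norm (s - 0)" if "s \<in> {0..}" "norm (s - 0) < r" for s
    proof (cases "s = 0")
      case False
      then have "0 < s" "s < r" using \<open>s \<in> {0..}\<close> \<open>norm (s - 0) < r\<close> by auto
      then obtain w where "c w = 0" "norm (w - (z + s *\<^sub>R t)) \<le> e * s" using r(2) by blast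
      then show ?thesis using near[of w s] \<open>0 < s\<close> by (simp add: y0 diff_diff_eq)
    qed simp
    then show "\<exists>d>0. \<forall>s\<in>{0..}. norm (s - 0) < d \<longrightarrow> norm (y s - y 0 - (s - 0) *\<^sub>R t) \<le> e * norm (s - 0)"
      using r(1) by blast
  qed
  then show ?thesis using that y0 y by (simp add: has_vector_derivative_def)
qed

lemma derivative_zero_on_tangent:
  fixes c :: "real^'n \<Rightarrow> real^'p" and J :: "real^'p^'n"
    and F :: "real^'n \<Rightarrow> 'b::real_normed_vector"
  assumes c: "continuous_on UNIV c" "c z = 0" "(c has_derivative (\<lambda>h. h v* J)) (at z)"
    and inj: "inj ((*v) J)" and t: "t v* J = 0"
    and F: "(F has_derivative D) (at z)" "\<And>y. c y = 0 \<Longrightarrow> F y = 0"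
  shows "D t = 0"
proof -
  obtain y where y: "y 0 = z" "\<And>s. c (y s) = 0" "(y has_vector_derivative t) (at 0 within {0..})"
    using tangent_curve[OF c inj t] by blast
  have "((F \<circ> y) has_vector_derivative D t) (at 0 within {0..})"
    using vector_derivative_diff_chain_within[OF y(3), of F D] F(1) y(1)
    by (simp add: has_derivative_at_withinI)
  moreover have "F \<circ> y = (\<lambda>_. 0)" using F(2) y(2) by auto
  moreover have "at (0::real) within {0..} \<noteq> bot"
  proof -
    have "{0..} - {0::real} = {0<..}" by auto
    then show ?thesis by (simp add: at_within_eq_bot_iff)
  qed
  ultimately show ?thesis
    by (metis has_vector_derivative_const vector_derivative_unique_within)
qed

text \<open>First-order optimality of \<open>z\<close>: along a curve with tangent \<open>t\<close> the squared distance to \<open>a\<close> has right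
derivative \<open>-2 * (t \<bullet> (a - z))\<close>, which cannot be negative; the same for \<open>- t\<close>.\<close>

lemma nearest_zero_displacement_normal:
  fixes c :: "real^'n \<Rightarrow> real^'p" and J :: "real^'p^'n"
  assumes c: "continuous_on UNIV c" "c z = 0" "(c has_derivative (\<lambda>h. h v* J)) (at z)"
    and inj: "inj ((*v) J)"
    and min: "\<And>w. c w = 0 \<Longrightarrow> norm (a - z) \<le> norm (a - w)"
  obtains v where "a - z = J *v v"
proof (rule normal_in_range[OF inj])
  have le: "t \<bullet> (a - z) \<le> 0" if t: "t v* J = 0" for t
  proof (rule ccontr)
    assume neg: "\<not> t \<bullet> (a - z) \<le> 0"
    obtain y where y: "y 0 = z" "\<And>s. c (y s) = 0" "(y has_vector_derivative t) (at 0 within {0..})"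
      using tangent_curve[OF c inj t] by blast
    have "((\<lambda>s. (a - y s) \<bullet> (a - y s)) has_real_derivative - 2 * (t \<bullet> (a - z))) (at 0 within {0..})"
      using y(3) unfolding has_field_derivative_def has_vector_derivative_def
      by (auto intro!: derivative_eq_intros simp: y(1) inner_commute)
    from has_real_derivative_neg_dec_right[OF this] neg
    obtain d where "d > 0" "\<forall>h>0. h \<in> {0..} \<longrightarrow> h < d \<longrightarrow>
        (a - y h) \<bullet> (a - y h) < (a - z) \<bullet> (a - z)" by (auto simp: y(1))
    then have "(a - y (d/2)) \<bullet> (a - y (d/2)) < (a - z) \<bullet> (a - z)" by auto
    then have "norm (a - y (d/2)) < norm (a - z)" by (simp add: norm_lt)
    then show False using min[OF y(2), of "d/2"] by simp
  qed
  show "t \<bullet> (a - z) = 0" if t: "t v* J = 0" for t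
  proof -
    have "(- t) v* J = 0" using t vector_matrix_mult_diff_distrib[of 0 t J] by simp
    then show ?thesis using le[OF t] le[of "- t"] by simp
  qed
qed (use that in blast)

section \<open>The radius on which the constraint Jacobian stays well conditioned\<close>

text \<open>A \<open>GREATEST\<close> element need not exist in general. Here the admissible radii are bounded by 1, nonempty since
\<open>sigma_min\<close> is positive at \<open>x\<close> and continuous, and contain their supremum because the condition passes
from an open ball to its closure.\<close>

lemma rho_properties:
  fixes c :: "real^'n \<Rightarrow> real^'p"
  assumes cont: "continuous_on UNIV (trjac c)" and pos: "sigma_c c x > 0"
  shows "0 < rho c x" and "y \<in> Theta c x \<Longrightarrow> sigma_c c x / 2 \<le> sigma_min (trjac c y)"
proof -
  define \<phi> where "\<phi> y = sigma_min (trjac c y)" for y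
  have \<phi>: "continuous_on UNIV \<phi>" unfolding \<phi>_def
    by (rule continuous_on_compose2[OF continuous_on_sigma_min cont]) simp
  have \<phi>0: "\<phi> y \<ge> 0" for y unfolding \<phi>_def by (rule sigma_min_nonneg)
  have px: "\<phi> x > 0" using pos by (simp add: \<phi>_def sigma_c_def)
  define P where "P r \<longleftrightarrow> r \<in> {0<..1} \<and> (INF y \<in> {y. norm (y - x) \<le> r}. \<phi> y) \<ge> \<phi> x / 2" for r
  have P: "P r \<longleftrightarrow> 0 < r \<and> r \<le> 1 \<and> (\<forall>y. norm (y - x) \<le> r \<longrightarrow> \<phi> x / 2 \<le> \<phi> y)" for r
  proof (cases "0 < r \<and> r \<le> 1")
    case True
    then have "x \<in> {y. norm (y - x) \<le> r}" by simp
    then have ne: "{y. norm (y - x) \<le> r} \<noteq> {}" by blast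
    have bdd: "bdd_below (\<phi> ` {y. norm (y - x) \<le> r})" using \<phi>0 by (intro bdd_belowI[of _ 0]) auto
    show ?thesis unfolding P_def using True le_cINF_iff[OF ne bdd] by auto
  qed (auto simp: P_def)
  define R where "R = Sup (Collect P)"
  have bdd: "bdd_above (Collect P)" using P by (intro bdd_aboveI[of _ 1]) auto
  obtain r0 where "P r0"
  proof -
    have "isCont \<phi> x" using \<phi> by (simp add: continuous_on_eq_continuous_at)
    then obtain d where d: "d > 0" "\<And>y. dist y x < d \<Longrightarrow> dist (\<phi> y) (\<phi> x) < \<phi> x / 2"
      using half_gt_zero[OF px] unfolding continuous_at_eps_delta by blast
    have "P (min 1 (d / 2))"
      unfolding P
    proof (intro conjI allI impI)
      fix y assume "norm (y - x) \<le> min 1 (d / 2)"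
      then have "dist y x < d" using d(1) by (simp add: dist_norm)
      from d(2)[OF this] show "\<phi> x / 2 \<le> \<phi> y" unfolding dist_real_def by linarith
    qed (use d(1) in auto)
    then show ?thesis using that by blast
  qed
  then have R: "r0 \<le> R" "0 < R" "R \<le> 1"
    unfolding R_def using bdd P cSup_upper[of r0 "Collect P"] cSup_least[of "Collect P" 1] by force+
  have "ball x R \<subseteq> {y. \<phi> x / 2 \<le> \<phi> y}"
  proof
    fix y assume "y \<in> ball x R"
    then obtain r where "P r" "norm (y - x) < r"
      unfolding R_def using less_cSupE[of "norm (y - x)" "Collect P"] \<open>P r0\<close>
      by (auto simp: dist_norm norm_minus_commute)
    then show "y \<in> {y. \<phi> x / 2 \<le> \<phi> y}" using P by simp
  qed
  moreover have "closed {y. \<phi> x / 2 \<le> \<phi> y}"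
    using \<phi> by (intro closed_Collect_le continuous_intros)
  ultimately have "closure (ball x R) \<subseteq> {y. \<phi> x / 2 \<le> \<phi> y}" by (simp add: closure_minimal)
  then have cb: "\<phi> x / 2 \<le> \<phi> y" if "norm (y - x) \<le> R" for y
    using R(2) that by (auto simp: dist_norm norm_minus_commute subset_iff)
  then have "P R" using R P by blast
  moreover have "r \<le> R" if "P r" for r unfolding R_def using that bdd by (simp add: cSup_upper)
  ultimately have "(GREATEST r. P r) = R" by (rule Greatest_equality)
  then have rho: "rho c x = R" unfolding rho_def P_def \<phi>_def by simp
  show "0 < rho c x" using R rho by simp
  show "sigma_c c x / 2 \<le> sigma_min (trjac c y)" if "y \<in> Theta c x"
    using cb[of y] that by (simp add: Theta_def rho \<phi>_def sigma_c_def)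
qed

lemma Theta_eq_cball: "Theta c x = cball x (rho c x)"
  by (auto simp: Theta_def dist_norm norm_minus_commute)

locale constraint_dissolving =
  fixes f :: "real^'n \<Rightarrow> real" and c :: "real^'n \<Rightarrow> real^'p" and A :: "real^'n \<Rightarrow> real^'n"
  assumes f_differentiable: "f differentiable (at y)"
    and c_differentiable: "c differentiable (at y)"
    and A_differentiable: "A differentiable (at y)"
    and lipschitz_grad: "locally_lipschitz (grad f)"
    and lipschitz_trjac_c: "locally_lipschitz (trjac c)"
    and lipschitz_trjac_A: "locally_lipschitz (trjac A)"
    and regular: "c z = 0 \<Longrightarrow> inj ((*v) (trjac c z))"
    and A_fixes: "c z = 0 \<Longrightarrow> A z = z"
    and A_dissolves: "c z = 0 \<Longrightarrow> trjac A z *v (trjac c z *v v) = 0"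
begin

abbreviation "Jc \<equiv> trjac c"
abbreviation "JA \<equiv> trjac A"
abbreviation "M \<equiv> M_A c A"

lemma c_has_derivative: "(c has_derivative (\<lambda>h. h v* Jc y)) (at y)"
  by (rule trjac_has_derivative[OF c_differentiable])

lemma A_has_derivative: "(A has_derivative (\<lambda>h. h v* JA y)) (at y)"
  by (rule trjac_has_derivative[OF A_differentiable])

lemma continuous_on_c: "continuous_on UNIV c"
  using c_has_derivative by (auto intro!: continuous_at_imp_continuous_on has_derivative_continuous)

lemma grad_dissolved: "grad (\<lambda>y. f (A y)) y = JA y *v grad f (A y)"
proof (rule grad_eqI)
  have "((\<lambda>y. f (A y)) has_derivative (\<lambda>h. grad f (A y) \<bullet> (h v* JA y))) (at y)"
    by (rule has_derivative_compose[OF A_has_derivative grad_has_derivative[OF f_differentiable]])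
  then show "((\<lambda>y. f (A y)) has_derivative (\<lambda>h. (JA y *v grad f (A y)) \<bullet> h)) (at y)"
    by (simp add: inner_vector_matrix_mult)
qed

lemma grad_penalty:
  "grad (penalty \<beta> f c A) y = JA y *v grad f (A y) + \<beta> *\<^sub>R (Jc y *v c y)"
proof (rule grad_eqI)
  have 1: "((\<lambda>y. f (A y)) has_derivative (\<lambda>h. grad f (A y) \<bullet> (h v* JA y))) (at y)"
    by (rule has_derivative_compose[OF A_has_derivative grad_has_derivative[OF f_differentiable]])
  have "((\<lambda>y. f (A y) + \<beta> / 2 * (c y \<bullet> c y)) has_derivative
      (\<lambda>h. grad f (A y) \<bullet> (h v* JA y) + \<beta> / 2 * (c y \<bullet> (h v* Jc y) + (h v* Jc y) \<bullet> c y))) (at y)"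
    by (intro has_derivative_add[OF 1 has_derivative_mult_right[OF has_derivative_inner]] c_has_derivative)
  moreover have "grad f (A y) \<bullet> (h v* JA y) + \<beta> / 2 * (c y \<bullet> (h v* Jc y) + (h v* Jc y) \<bullet> c y)
      = (JA y *v grad f (A y) + \<beta> *\<^sub>R (Jc y *v c y)) \<bullet> h" for h
    by (simp add: inner_add_left inner_vector_matrix_mult inner_commute[of "h v* Jc y"])
  ultimately show "(penalty \<beta> f c A has_derivative
      (\<lambda>h. (JA y *v grad f (A y) + \<beta> *\<^sub>R (Jc y *v c y)) \<bullet> h)) (at y)"
    unfolding penalty_def power2_norm_eq_inner by simp
qed

section \<open>The dissolving map at a feasible point\<close>

text \<open>Since \<open>trjac A z\<close> annihilates the columns of \<open>trjac c z\<close>, the image of its transpose is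
orthogonal to them.\<close>

lemma JA_image_tangent: "c z = 0 \<Longrightarrow> (d v* JA z) v* Jc z = 0"
proof -
  assume z: "c z = 0"
  let ?w = "(d v* JA z) v* Jc z"
  have "?w \<bullet> ?w = d \<bullet> (JA z *v (Jc z *v ?w))" by (simp add: dot_lmul_matrix)
  then show "?w = 0" using A_dissolves[OF z] by simp
qed

text \<open>The function \<open>A y - y\<close> vanishes on the feasible set.\<close>

lemma JA_tangent: "c z = 0 \<Longrightarrow> t v* Jc z = 0 \<Longrightarrow> t v* JA z = t"
proof -
  assume z: "c z = 0" and t: "t v* Jc z = 0"
  have "((\<lambda>y. A y - y) has_derivative (\<lambda>h. h v* JA z - h)) (at z)"
    by (intro derivative_intros A_has_derivative)
  from derivative_zero_on_tangent[OF continuous_on_c z c_has_derivative regular[OF z] t this]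
  show ?thesis using A_fixes by simp
qed

text \<open>Since \<open>trjac A z\<close> is the transpose of a map fixing all tangents, a vector in its kernel is orthogonal to
every tangent.\<close>

lemma JA_kernel:
  assumes z: "c z = 0" and w: "JA z *v w = 0"
  obtains l where "w = Jc z *v l"
proof (rule normal_in_range[OF regular[OF z]])
  fix t assume "t v* Jc z = 0"
  then have "t \<bullet> w = (t v* JA z) \<bullet> w" using JA_tangent[OF z] by simp
  then show "t \<bullet> w = 0" using w by (simp add: dot_lmul_matrix)
qed (use that in blast)

lemma first_order_OCP_iff: "first_order_OCP f c z \<longleftrightarrow> c z = 0 \<and> (\<exists>l. grad f z = Jc z *v l)"
  unfolding first_order_OCP_def by (simp add: grad_component[OF c_differentiable] column_sum_matrix_vector)

lemma grad_penalty_feasible: "c z = 0 \<Longrightarrow> grad (penalty \<beta> f c A) z = JA z *v grad f z"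
  by (simp add: grad_penalty A_fixes)

text \<open>The Gram matrix is invertible, so the normal equations recover \<open>l\<close> from \<open>trjac c z *v l\<close>: the
least-squares multiplier is the one that witnesses stationarity.\<close>

lemma multiplier_eq:
  assumes z: "c z = 0" and l: "grad f z = Jc z *v l"
  shows "multiplier f c z = l"
proof -
  define G where "G = transpose (Jc z) ** Jc z"
  have G: "G *v v = (Jc z *v v) v* Jc z" for v
    by (simp add: G_def matrix_vector_mul_assoc[symmetric])
  obtain g where "\<And>v. g ((Jc z *v v) v* Jc z) = v"
    using regular_point_gram_inverse[OF regular[OF z]] by metis
  then have "inj ((*v) G)" by (metis G injI)
  then have "invertible G"
    using invertible_left_inverse matrix_left_invertible_injective by blast
  then have "\<exists>G'. G ** G' = mat 1 \<and> G' ** G = mat 1" by (simp add: invertible_def)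
  then have "matrix_inv G ** G = mat 1"
    unfolding matrix_inv_def by (rule someI2_ex) simp
  moreover have "multiplier f c z = (matrix_inv G ** G) *v l"
    unfolding multiplier_def G_def[symmetric] matrix_vector_mul_assoc[symmetric] by (simp add: l G)
  ultimately show ?thesis by simp
qed

section \<open>Bounds on the neighbourhood of a feasible point\<close>

lemma sigma_c_pos: "c x = 0 \<Longrightarrow> sigma_c c x > 0"
  unfolding sigma_c_def by (rule sigma_min_pos[OF regular])

lemmas rho_pos = rho_properties(1)[OF locally_lipschitz_continuous_on[OF lipschitz_trjac_c] sigma_c_pos]
lemmas sigma_min_Theta = rho_properties(2)[OF locally_lipschitz_continuous_on[OF lipschitz_trjac_c] sigma_c_pos]

text \<open>Local Lipschitz continuity is assumed of \<open>trjac A\<close> rather than of \<open>A\<close>; the latter follows from boundedness of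
the Jacobian on compact convex sets.\<close>

lemma A_lipschitz_on:
  assumes S: "compact S" "convex S"
  obtains L where "L-lipschitz_on S A"
proof -
  obtain K where K: "K > 0" "\<And>N :: real^'n^'n. opnorm N \<le> K * norm N" using opnorm_le_norm by blast
  have "compact (JA ` S)"
    using S(1) locally_lipschitz_continuous_on[OF lipschitz_trjac_A]
    by (meson compact_continuous_image continuous_on_subset subset_UNIV)
  then obtain B where B: "\<And>y. y \<in> S \<Longrightarrow> norm (JA y) \<le> B" "B > 0"
    by (metis compact_imp_bounded bounded_pos imageI)
  have "(K * B)-lipschitz_on S A"
  proof (rule bounded_derivative_imp_lipschitz)
    fix y assume y: "y \<in> S"
    show "(A has_derivative (\<lambda>h. h v* JA y)) (at y within S)"
      by (rule has_derivative_at_withinI[OF A_has_derivative])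
    have "opnorm (JA y) \<le> K * B" using K B(1)[OF y] by (meson mult_left_mono order_trans less_imp_le)
    then show "onorm (\<lambda>h. h v* JA y) \<le> K * B"
      by (intro onorm_le order_trans[OF norm_vector_matrix_mult_le] mult_right_mono) auto
  qed (use S K B in auto)
  then show ?thesis using that by blast
qed

lemma compose_A_lipschitz_on:
  assumes F: "locally_lipschitz F" and S: "compact S" "convex S"
  obtains L where "L-lipschitz_on S (\<lambda>y. F (A y))"
proof -
  obtain K where K: "K-lipschitz_on S A" using A_lipschitz_on[OF S] by blast
  then have "compact (A ` S)" using S(1) compact_continuous_image lipschitz_on_continuous_on by blast
  then obtain L where "L-lipschitz_on (A ` S) F" using locally_lipschitz_on_compact[OF F] by blast
  then show ?thesis using lipschitz_on_compose2[OF K] that by blast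
qed

lemma lip_grad_dissolved:
  assumes "y \<in> Theta c x" "z \<in> Theta c x"
  shows "norm (JA y *v grad f (A y) - JA z *v grad f (A z)) \<le> L_g f c A x * norm (y - z)"
proof -
  have S: "compact (Theta c x)" "convex (Theta c x)" by (simp_all add: Theta_eq_cball)
  obtain L1 where L1: "L1-lipschitz_on (Theta c x) JA"
    using locally_lipschitz_on_compact[OF lipschitz_trjac_A S(1)] .
  obtain L2 where L2: "L2-lipschitz_on (Theta c x) (\<lambda>y. grad f (A y))"
    using compose_A_lipschitz_on[OF lipschitz_grad S] .
  obtain L where "L-lipschitz_on (Theta c x) (\<lambda>y. JA y *v grad f (A y))"
    using lipschitz_on_bounded_bilinear[OF bounded_bilinear_matrix_vector_mult S(1) L1 L2] .
  then have "L-lipschitz_on (Theta c x) (grad (\<lambda>y. f (A y)))" by (simp add: grad_dissolved)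
  from lip_const_norm[OF this assms] show ?thesis by (simp add: L_g_def grad_dissolved)
qed

lemma lip_product:
  assumes "y \<in> Theta c x" "z \<in> Theta c x"
  shows "opnorm (JA y ** Jc (A y) - JA z ** Jc (A z)) \<le> L_b c A x * norm (y - z)"
proof -
  have S: "compact (Theta c x)" "convex (Theta c x)" by (simp_all add: Theta_eq_cball)
  obtain L1 where L1: "L1-lipschitz_on (Theta c x) JA"
    using locally_lipschitz_on_compact[OF lipschitz_trjac_A S(1)] .
  obtain L2 where L2: "L2-lipschitz_on (Theta c x) (\<lambda>y. Jc (A y))"
    using compose_A_lipschitz_on[OF lipschitz_trjac_c S] .
  obtain L where "L-lipschitz_on (Theta c x) (\<lambda>y. JA y ** Jc (A y))"
    using lipschitz_on_bounded_bilinear[OF bounded_bilinear_matrix_matrix_mult S(1) L1 L2] .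
  from lip_const_opnorm[OF this assms] show ?thesis by (simp add: L_b_def)
qed

lemma lip_trjac_c:
  assumes "y \<in> Theta c x" "z \<in> Theta c x"
  shows "opnorm (Jc y - Jc z) \<le> L_c c x * norm (y - z)"
proof -
  obtain L where "L-lipschitz_on (Theta c x) Jc"
    using locally_lipschitz_on_compact[OF lipschitz_trjac_c, of "Theta c x"] by (auto simp: Theta_eq_cball)
  from lip_const_opnorm[OF this assms] show ?thesis by (simp add: L_c_def)
qed

lemma Theta_two_points:
  assumes "c x = 0"
  obtains y z where "y \<in> Theta c x" "z \<in> Theta c x" "y \<noteq> z"
proof -
  have "x \<in> Theta c x" "x + rho c x *\<^sub>R axis undefined 1 \<in> Theta c x"
    "x \<noteq> x + rho c x *\<^sub>R axis undefined 1"
    using rho_pos[OF assms] by (auto simp: Theta_def)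
  then show ?thesis using that by blast
qed

lemma L_nonneg:
  assumes "c x = 0"
  shows "L_g f c A x \<ge> 0" "L_b c A x \<ge> 0" "L_c c x \<ge> 0"
proof -
  obtain y z where yz: "y \<in> Theta c x" "z \<in> Theta c x" "y \<noteq> z" using Theta_two_points[OF assms] .
  then have pos: "norm (y - z) > 0" by simp
  have nn: "0 \<le> L" if "a \<le> L * norm (y - z)" "0 \<le> a" for a L
    using order_trans[OF that(2,1)] pos by (simp add: zero_le_mult_iff)
  show "L_g f c A x \<ge> 0" using nn[OF lip_grad_dissolved[OF yz(1,2)] norm_ge_zero] .
  show "L_b c A x \<ge> 0" using nn[OF lip_product[OF yz(1,2)] opnorm_nonneg] .
  show "L_c c x \<ge> 0" using nn[OF lip_trjac_c[OF yz(1,2)] opnorm_nonneg] .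
qed

lemma opnorm_JA_le:
  assumes "y \<in> Theta c x"
  shows "opnorm (JA y) \<le> M x"
proof -
  obtain K where K: "K > 0" "\<And>N :: real^'n^'n. opnorm N \<le> K * norm N" using opnorm_le_norm by blast
  have "compact (JA ` Theta c x)"
    using locally_lipschitz_continuous_on[OF lipschitz_trjac_A]
    by (metis Theta_eq_cball compact_cball compact_continuous_image continuous_on_subset subset_UNIV)
  then obtain B where B: "\<And>y. y \<in> Theta c x \<Longrightarrow> norm (JA y) \<le> B"
    by (metis compact_imp_bounded bounded_iff imageI)
  have "bdd_above ((\<lambda>y. opnorm (JA y)) ` Theta c x)"
    using K B by (intro bdd_aboveI[of _ "K * B"]) (auto intro: order_trans[OF K(2)])
  then show ?thesis unfolding M_A_def using assms by (rule cSUP_upper2) simp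
qed

lemma norm_grad_le:
  assumes "y \<in> Theta c x"
  shows "norm (grad f (A y)) \<le> M_f f c A x"
proof -
  have S: "compact (Theta c x)" "convex (Theta c x)" by (simp_all add: Theta_eq_cball)
  obtain L where "L-lipschitz_on (Theta c x) (\<lambda>y. grad f (A y))"
    using compose_A_lipschitz_on[OF lipschitz_grad S] .
  then have "compact ((\<lambda>y. grad f (A y)) ` Theta c x)"
    using S(1) compact_continuous_image lipschitz_on_continuous_on by blast
  then obtain B where B: "\<And>y. y \<in> Theta c x \<Longrightarrow> norm (grad f (A y)) \<le> B"
    by (metis (no_types, lifting) compact_imp_bounded bounded_iff imageI)
  then have "bdd_above ((\<lambda>y. norm (grad f (A y))) ` Theta c x)" by (intro bdd_aboveI[of _ B]) auto
  then show ?thesis unfolding M_f_def using assms by (rule cSUP_upper2) simp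
qed

lemma center_in_Theta: "c x = 0 \<Longrightarrow> x \<in> Theta c x"
  using rho_pos by (simp add: Theta_def less_imp_le)

lemma M_nonneg:
  assumes "c x = 0" shows "M x \<ge> 0" "M_f f c A x \<ge> 0"
  using opnorm_JA_le[OF center_in_Theta[OF assms]] norm_grad_le[OF center_in_Theta[OF assms]]
    opnorm_nonneg[of "JA x"] norm_ge_zero[of "grad f (A x)"] by linarith+

text \<open>The second bound is multiplied out: it then also covers \<open>L_c c x = 0\<close>, where the extended real quotient
is infinite.\<close>

lemma OmegaD:
  assumes x: "c x = 0" and y: "y \<in> Omega c A x"
  shows "norm (y - x) \<le> rho c x / 2"
    and "L_c c x * (M x + 1) * norm (y - x) \<le> sigma_c c x / 32"
proof -
  have e: "ereal (norm (y - x)) \<le> eps_x c A x" using y by (simp add: Omega_def)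
  then have "ereal (norm (y - x)) \<le> ereal (rho c x / 2)"
    unfolding eps_x_def by (meson min.boundedE)
  then show "norm (y - x) \<le> rho c x / 2" by simp
  have e2: "ereal (norm (y - x)) \<le> ereal (sigma_c c x) / ereal (32 * L_c c x * (M x + 1))"
    using e unfolding eps_x_def by (meson min.boundedE)
  show "L_c c x * (M x + 1) * norm (y - x) \<le> sigma_c c x / 32"
  proof (cases "L_c c x = 0")
    case True then show ?thesis using sigma_c_pos[OF x] by simp
  next
    case False
    then have "L_c c x * (M x + 1) > 0" using L_nonneg(3)[OF x] M_nonneg(1)[OF x] by simp
    then show ?thesis using e2 by (simp add: field_simps)
  qed
qed

lemma Omega_subset_Theta: "c x = 0 \<Longrightarrow> y \<in> Omega c A x \<Longrightarrow> y \<in> Theta c x"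
  using OmegaD(1)[of x y] rho_pos[of x] by (simp add: Theta_def)

lemma beta_xD:
  assumes x: "c x = 0" and \<beta>: "\<beta> \<ge> beta_x f c A x"
  shows "128 * L_g f c A x * (M x + 1)\<^sup>2 \<le> \<beta> * (sigma_c c x)\<^sup>2"
    and "64 * M_f f c A x * (M x + 1) * L_b c A x \<le> \<beta> * (sigma_c c x) ^ 3"
  using \<beta> sigma_c_pos[OF x] unfolding beta_x_def by (auto simp: field_simps)

section \<open>Critical points of the penalty function are feasible\<close>

lemma c_linearization:
  assumes x: "c x = 0" and yz: "y \<in> Theta c x" "z \<in> Theta c x"
  shows "norm (c y - c z - (y - z) v* Jc z) \<le> norm (y - z) * (L_c c x * norm (y - z))"
proof -
  let ?S = "closed_segment z y"
  have S: "?S \<subseteq> Theta c x"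
    using yz unfolding Theta_eq_cball by (intro closed_segment_subset convex_cball)
  show ?thesis
  proof (rule differentiable_bound_linearization[where S = ?S])
    show "z + t *\<^sub>R (y - z) \<in> ?S" if "t \<in> {0..1}" for t
    proof -
      have "z + t *\<^sub>R (y - z) = (1 - t) *\<^sub>R z + t *\<^sub>R y" by (simp add: algebra_simps)
      then show ?thesis using that unfolding in_segment by auto
    qed
    show "(c has_derivative (\<lambda>h. h v* Jc w)) (at w within ?S)" for w
      by (rule has_derivative_at_withinI[OF c_has_derivative])
    show "onorm ((\<lambda>h. h v* Jc w) - (\<lambda>h. h v* Jc z)) \<le> L_c c x * norm (y - z)" if w: "w \<in> ?S" for w
    proof (rule onorm_le)
      fix h :: "real^'n"
      have "opnorm (Jc w - Jc z) \<le> L_c c x * norm (w - z)"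
        using lip_trjac_c[OF subsetD[OF S w] yz(2)] .
      also have "\<dots> \<le> L_c c x * norm (y - z)"
        using segment_bound(1)[OF w] L_nonneg(3)[OF x] by (intro mult_left_mono) auto
      finally have "opnorm (Jc w - Jc z) * norm h \<le> L_c c x * norm (y - z) * norm h"
        by (intro mult_right_mono) auto
      then have "norm (h v* (Jc w - Jc z)) \<le> L_c c x * norm (y - z) * norm h"
        by (rule order_trans[OF norm_vector_matrix_mult_le])
      then show "norm (((\<lambda>h. h v* Jc w) - (\<lambda>h. h v* Jc z)) h) \<le> L_c c x * norm (y - z) * norm h"
        by (simp add: vector_matrix_mult_diff_rdistrib)
    qed
  qed auto
qed

text \<open>In the application \<open>q = e v* J\<close>, and both \<open>c y\<close> and the derivative of \<open>c\<close> at \<open>y\<close> along the test direction differ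
from \<open>q\<close> by at most a sixteenth of its norm.\<close>

lemma inner_perturbed_lower_bound:
  fixes q r p :: "'a::real_inner"
  assumes "norm r \<le> norm q / 16" "norm p \<le> norm q / 16"
  shows "(norm q)\<^sup>2 / 2 \<le> (q + r) \<bullet> (q + p)"
proof -
  have "\<bar>q \<bullet> p\<bar> \<le> norm q * (norm q / 16)"
    using assms by (intro order_trans[OF Cauchy_Schwarz_ineq2 mult_mono]) simp_all
  moreover have "\<bar>r \<bullet> q\<bar> \<le> norm q / 16 * norm q"
    using assms by (intro order_trans[OF Cauchy_Schwarz_ineq2 mult_mono]) simp_all
  moreover have "\<bar>r \<bullet> p\<bar> \<le> norm q / 16 * (norm q / 16)"
    using assms by (intro order_trans[OF Cauchy_Schwarz_ineq2 mult_mono]) simp_all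
  moreover have "(q + r) \<bullet> (q + p) = (norm q)\<^sup>2 + q \<bullet> p + r \<bullet> q + r \<bullet> p"
    by (simp add: inner_add_left inner_add_right power2_norm_eq_inner)
  ultimately show ?thesis by (simp add: power2_eq_square)
qed

theorem critical_point_feasible:
  assumes x: "c x = 0" and \<beta>: "\<beta> \<ge> beta_x f c A x" "\<beta> > 0"
    and y: "y \<in> Omega c A x" and crit: "grad (penalty \<beta> f c A) y = 0"
  shows "c y = 0"
proof -
  define \<sigma> where "\<sigma> = sigma_c c x"
  define m where "m = M x + 1"
  define G where "G = L_g f c A x"
  define L where "L = L_c c x"
  have \<sigma>: "\<sigma> > 0" using sigma_c_pos[OF x] by (simp add: \<sigma>_def)
  have m: "m \<ge> 1" using M_nonneg[OF x] by (simp add: m_def)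
  have GL: "G \<ge> 0" "L \<ge> 0" using L_nonneg[OF x] by (simp_all add: G_def L_def)
  define Z where "Z = {z. c z = 0}"
  have Z: "closed Z" "Z \<noteq> {}"
    using x continuous_closed_preimage_constant[OF continuous_on_c closed_UNIV, of 0] by (auto simp: Z_def)
  define z where "z = closest_point Z y"
  have z: "c z = 0" using closest_point_in_set[OF Z] by (simp add: z_def Z_def)
  have min: "norm (y - z) \<le> norm (y - w)" if "c w = 0" for w
    using closest_point_exists(2)[OF Z, of y] that by (simp add: z_def Z_def dist_norm)
  define e where "e = y - z"
  have ey: "norm e \<le> norm (y - x)" using min[OF x] by (simp add: e_def)
  have yT: "y \<in> Theta c x" using Omega_subset_Theta[OF x y] .
  \<comment> \<open>The factor one half in the radius leaves room for the projection to stay in \<open>Theta c x\<close>.\<close>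
  have zT: "z \<in> Theta c x"
  proof -
    have "norm (z - x) \<le> norm (y - x) + norm e"
      using norm_triangle_ineq4[of "y - x" e] by (simp add: e_def)
    then show ?thesis using ey OmegaD(1)[OF x y] by (simp add: Theta_def)
  qed
  obtain v where v: "e = Jc z *v v"
    using nearest_zero_displacement_normal[OF continuous_on_c z c_has_derivative regular[OF z], of y] min
    unfolding e_def by blast
  define q where "q = e v* Jc z"
  have q: "\<sigma> / 2 * norm e \<le> norm q"
  proof -
    have "\<sigma> / 2 * norm e \<le> sigma_min (Jc z) * norm e"
      using sigma_min_Theta[OF x zT] unfolding \<sigma>_def by (intro mult_right_mono) auto
    also have "\<dots> \<le> norm q" unfolding q_def v by (rule sigma_min_le_transpose)
    finally show ?thesis .
  qed
  have small: "L * m * norm e \<le> \<sigma> / 32"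
  proof -
    have "L * m * norm e \<le> L * m * norm (y - x)" using ey GL m by (intro mult_left_mono) auto
    then show ?thesis using OmegaD(2)[OF x y] by (simp add: L_def m_def \<sigma>_def)
  qed
  \<comment> \<open>The test direction: the derivative of \<open>A\<close> at \<open>z\<close> vanishes on \<open>u\<close>, which removes the gradient of
  \<open>f (A y)\<close> at \<open>z\<close>, while \<open>u\<close> and \<open>e\<close> have the same normal component.\<close>
  define u where "u = e - e v* JA z"
  have uq: "u v* Jc z = q"
    using JA_image_tangent[OF z] by (simp add: u_def q_def vector_matrix_mult_diff_distrib)
  have uA: "u v* JA z = 0"
    using JA_tangent[OF z JA_image_tangent[OF z]] by (simp add: u_def vector_matrix_mult_diff_distrib)
  have nu: "norm u \<le> m * norm e"
  proof -
    have "norm u \<le> norm e + norm (e v* JA z)" unfolding u_def by (rule norm_triangle_ineq4)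
    also have "\<dots> \<le> norm e + M x * norm e"
      using norm_vector_matrix_mult_le[of e "JA z"] mult_right_mono[OF opnorm_JA_le[OF zT], of "norm e"]
      by simp
    finally show ?thesis by (simp add: m_def algebra_simps)
  qed
  define r where "r = c y - q"
  define p where "p = u v* Jc y - q"
  have "norm r \<le> norm e * (L * norm e)"
    using c_linearization[OF x yT zT] z by (simp add: r_def q_def e_def L_def)
  also have "\<dots> \<le> norm e * (L * m * norm e)"
    using GL m mult_left_mono[of 1 m L] by (intro mult_left_mono mult_right_mono) auto
  also have "\<dots> \<le> norm e * (\<sigma> / 32)" using small by (intro mult_left_mono) auto
  also have "\<dots> \<le> norm q / 16" using q by simp
  finally have r: "norm r \<le> norm q / 16" .
  have "norm p = norm (u v* (Jc y - Jc z))"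
    by (simp add: p_def uq[symmetric] vector_matrix_mult_diff_rdistrib)
  also have "\<dots> \<le> (L * norm e) * (m * norm e)"
    using lip_trjac_c[OF yT zT] nu GL
    by (intro order_trans[OF norm_vector_matrix_mult_le] mult_mono) (auto simp: L_def e_def)
  also have "\<dots> = norm e * (L * m * norm e)" by simp
  also have "\<dots> \<le> norm e * (\<sigma> / 32)" using small by (intro mult_left_mono) auto
  also have "\<dots> \<le> norm q / 16" using q by simp
  finally have p: "norm p \<le> norm q / 16" .
  have "(\<sigma> / 2 * norm e)\<^sup>2 \<le> (norm q)\<^sup>2" using q \<sigma> by (intro power_mono) auto
  then have "\<sigma>\<^sup>2 * (norm e)\<^sup>2 / 8 \<le> (norm q)\<^sup>2 / 2" by (simp add: power_mult_distrib power_divide)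
  also have "\<dots> \<le> (q + r) \<bullet> (q + p)" by (rule inner_perturbed_lower_bound[OF r p])
  also have "\<dots> = c y \<bullet> (u v* Jc y)" by (simp add: r_def p_def)
  finally have low: "\<sigma>\<^sup>2 * (norm e)\<^sup>2 / 8 \<le> c y \<bullet> (u v* Jc y)" .
  define g where "g w = JA w *v grad f (A w)" for w
  have "u \<bullet> g z = 0" using uA by (simp add: g_def dot_lmul_matrix[symmetric])
  then have "\<bar>u \<bullet> g y\<bar> = \<bar>u \<bullet> (g y - g z)\<bar>" by (simp add: inner_diff_right)
  also have "\<dots> \<le> norm u * norm (g y - g z)" by (rule Cauchy_Schwarz_ineq2)
  also have "\<dots> \<le> (m * norm e) * (G * norm e)"
    using nu lip_grad_dissolved[OF yT zT] m by (intro mult_mono) (auto simp: g_def G_def e_def)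
  finally have up: "\<bar>u \<bullet> g y\<bar> \<le> G * m * (norm e)\<^sup>2" by (simp add: power2_eq_square mult_ac)
  have "0 = u \<bullet> (g y + \<beta> *\<^sub>R (Jc y *v c y))" using crit by (simp add: grad_penalty g_def)
  also have "\<dots> = u \<bullet> g y + \<beta> * (c y \<bullet> (u v* Jc y))"
    by (simp add: inner_add_right dot_lmul_matrix inner_commute[of "c y"])
  finally have "\<beta> * (c y \<bullet> (u v* Jc y)) \<le> G * m * (norm e)\<^sup>2" using up by linarith
  moreover have "\<beta> * (\<sigma>\<^sup>2 * (norm e)\<^sup>2 / 8) \<le> \<beta> * (c y \<bullet> (u v* Jc y))"
    using low \<beta>(2) by (intro mult_left_mono) auto
  ultimately have main: "\<beta> * \<sigma>\<^sup>2 * (norm e)\<^sup>2 \<le> 8 * (G * m) * (norm e)\<^sup>2" by simp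
  \<comment> \<open>The threshold on \<open>\<beta>\<close> makes the right-hand side of \<open>main\<close> at most one sixteenth of its left-hand
  side.\<close>
  have "128 * (G * m) * 1 \<le> 128 * (G * m) * m" using GL m by (intro mult_left_mono) auto
  then have "128 * (G * m) \<le> 128 * G * m\<^sup>2" by (simp add: power2_eq_square mult_ac)
  also have "\<dots> \<le> \<beta> * \<sigma>\<^sup>2" using beta_xD(1)[OF x \<beta>(1)] by (simp add: G_def m_def \<sigma>_def)
  finally have "8 * (G * m) \<le> \<beta> * \<sigma>\<^sup>2 / 16" by simp
  then have "8 * (G * m) * (norm e)\<^sup>2 \<le> \<beta> * \<sigma>\<^sup>2 / 16 * (norm e)\<^sup>2" by (rule mult_right_mono) simp
  with main have "\<beta> * \<sigma>\<^sup>2 * (norm e)\<^sup>2 \<le> 0" by simp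
  then have "(norm e)\<^sup>2 \<le> 0" using \<beta>(2) \<sigma> by (simp add: mult_le_0_iff)
  then show ?thesis using z by (simp add: e_def)
qed

section \<open>The Hessian of the penalty function at a feasible point\<close>

text \<open>The gradient of \<open>l \<bullet> c (A y)\<close>, a field that vanishes on the feasible set. Its Lipschitz constant on
\<open>Theta c x\<close> is at most \<open>L_b c A x * norm l\<close>.\<close>

definition dissolved_normal :: "real^'p \<Rightarrow> real^'n \<Rightarrow> real^'n" where
  "dissolved_normal l y = JA y *v (Jc (A y) *v l)"

lemma dissolved_normal_is_gradient:
  "((\<lambda>y. l \<bullet> c (A y)) has_derivative (\<lambda>h. dissolved_normal l y \<bullet> h)) (at y)"
proof -
  have "((\<lambda>y. l \<bullet> c (A y)) has_derivative (\<lambda>h. l \<bullet> ((h v* JA y) v* Jc (A y)))) (at y)"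
    by (intro has_derivative_inner_right has_derivative_compose[OF A_has_derivative c_has_derivative])
  then show ?thesis by (simp add: dissolved_normal_def inner_vector_matrix_mult)
qed

lemma dissolved_normal_feasible: "c y = 0 \<Longrightarrow> dissolved_normal l y = 0"
  by (simp add: dissolved_normal_def A_fixes A_dissolves)

context
  fixes z l D
  assumes z: "c z = 0" and D: "(dissolved_normal l has_derivative D) (at z)"
begin

lemma dissolved_normal_derivative_symmetric: "D u \<bullet> v = D v \<bullet> u"
  by (rule second_derivative_symmetric[OF dissolved_normal_is_gradient D])

lemma dissolved_normal_derivative_tangent: "t v* Jc z = 0 \<Longrightarrow> D t = 0"
  by (rule derivative_zero_on_tangent[OF continuous_on_c z c_has_derivative regular[OF z] _ D])
    (auto intro: dissolved_normal_feasible)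

lemma dissolved_normal_derivative_norm_le:
  assumes x: "c x = 0" and near: "norm (z - x) \<le> rho c x / 2"
  shows "norm (D u) \<le> L_b c A x * norm l * norm u"
proof (rule derivative_bounded_by_lipschitz[OF D])
  have \<rho>: "rho c x > 0" by (rule rho_pos[OF x])
  then show "rho c x / 2 > 0" by simp
  show "L_b c A x * norm l \<ge> 0" using L_nonneg[OF x] by simp
  fix y assume "norm (y - z) < rho c x / 2"
  then have yT: "y \<in> Theta c x"
    using near norm_triangle_ineq[of "y - z" "z - x"] by (simp add: Theta_def)
  have zT: "z \<in> Theta c x" using near \<rho> by (simp add: Theta_def)
  have "norm (dissolved_normal l y - dissolved_normal l z) = norm ((JA y ** Jc (A y) - JA z ** Jc (A z)) *v l)"
    by (simp add: dissolved_normal_def matrix_vector_mult_diff_rdistrib matrix_vector_mul_assoc)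
  also have "\<dots> \<le> (L_b c A x * norm (y - z)) * norm l"
    using lip_product[OF yT zT] by (intro order_trans[OF norm_matrix_vector_mult_le] mult_right_mono) auto
  finally show "norm (dissolved_normal l y - dissolved_normal l z) \<le> L_b c A x * norm l * norm (y - z)"
    by (simp add: mult_ac)
qed

text \<open>Only the normal component \<open>u\<close> of \<open>d\<close> contributes to either term: tangents are annihilated by \<open>D\<close>, on both sides by
symmetry. The first term is at least \<open>- L_b * norm l * norm u\<^sup>2\<close>, where \<open>norm l\<close> is at most
\<open>2 * M_f / \<sigma>\<close>, and the second is at least \<open>\<beta> * \<sigma>\<^sup>2 / 4 * norm u\<^sup>2\<close>.\<close>

lemma dissolved_normal_curvature_bound:
  assumes x: "c x = 0" and near: "norm (z - x) \<le> rho c x / 2"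
    and \<beta>: "\<beta> \<ge> beta_x f c A x" "\<beta> > 0" and l: "grad f z = Jc z *v l"
  shows "0 \<le> d \<bullet> D d + \<beta> * (norm (d v* Jc z))\<^sup>2"
proof -
  define \<sigma> where "\<sigma> = sigma_c c x"
  have \<sigma>: "\<sigma> > 0" using sigma_c_pos[OF x] by (simp add: \<sigma>_def)
  have zT: "z \<in> Theta c x" using near rho_pos[OF x] by (simp add: Theta_def)
  have sz: "\<sigma> / 2 \<le> sigma_min (Jc z)" using sigma_min_Theta[OF x zT] by (simp add: \<sigma>_def)
  define B where "B = L_b c A x"
  have B: "B \<ge> 0" using L_nonneg[OF x] by (simp add: B_def)
  have linD: "linear D" using D by (rule has_derivative_linear)
  obtain v where v: "(d - Jc z *v v) v* Jc z = 0"
    using tangent_normal_decomposition[OF regular[OF z]] by blast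
  define u where "u = Jc z *v v"
  have Dd: "D d = D u"
    using dissolved_normal_derivative_tangent[OF v] linear_diff[OF linD, of d u] by (simp add: u_def)
  have "D u \<bullet> (d - u) = D (d - u) \<bullet> u" by (rule dissolved_normal_derivative_symmetric)
  also have "\<dots> = 0" using dissolved_normal_derivative_tangent[OF v] by (simp add: u_def)
  finally have "d \<bullet> D d = u \<bullet> D u" using Dd by (simp add: inner_diff_right inner_commute)
  moreover have "\<bar>u \<bullet> D u\<bar> \<le> norm u * (B * norm l * norm u)"
    unfolding B_def by (intro order_trans[OF Cauchy_Schwarz_ineq2] mult_left_mono dissolved_normal_derivative_norm_le[OF x near]) simp
  ultimately have low: "d \<bullet> D d \<ge> - (B * norm l * (norm u)\<^sup>2)"
    by (simp add: power2_eq_square mult_ac abs_le_iff)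
  have "d v* Jc z = u v* Jc z" using v by (simp add: u_def vector_matrix_mult_diff_distrib)
  moreover have "\<sigma> / 2 * norm u \<le> norm (u v* Jc z)"
  proof -
    have "\<sigma> / 2 * norm u \<le> sigma_min (Jc z) * norm u" using sz by (intro mult_right_mono) auto
    also have "\<dots> \<le> norm (u v* Jc z)" unfolding u_def by (rule sigma_min_le_transpose)
    finally show ?thesis .
  qed
  ultimately have "(\<sigma> / 2 * norm u)\<^sup>2 \<le> (norm (d v* Jc z))\<^sup>2" using \<sigma> by (intro power_mono) auto
  then have pen: "\<beta> * (\<sigma> / 2 * norm u)\<^sup>2 \<le> \<beta> * (norm (d v* Jc z))\<^sup>2"
    using \<beta>(2) by (intro mult_left_mono) auto
  have "\<sigma> / 2 * norm l \<le> sigma_min (Jc z) * norm l" using sz by (intro mult_right_mono) auto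
  also have "\<dots> \<le> norm (grad f (A z))" unfolding A_fixes[OF z] l by (rule sigma_min_le)
  also have "\<dots> \<le> M_f f c A x" by (rule norm_grad_le[OF zT])
  finally have "\<sigma> / 2 * norm l \<le> M_f f c A x" .
  then have "B * (\<sigma> / 2 * norm l) \<le> B * M_f f c A x" using B by (rule mult_left_mono)
  also have "\<dots> = B * M_f f c A x * 1" by simp
  also have "\<dots> \<le> B * M_f f c A x * (M x + 1)"
    using B M_nonneg[OF x] by (intro mult_left_mono) auto
  finally have "64 * (B * (\<sigma> / 2 * norm l)) \<le> 64 * (B * M_f f c A x * (M x + 1))" by simp
  also have "\<dots> \<le> \<beta> * \<sigma> ^ 3" using beta_xD(2)[OF x \<beta>(1)] by (simp add: B_def \<sigma>_def mult_ac)
  finally have "\<sigma> * (32 * (B * norm l)) \<le> \<sigma> * (\<beta> * \<sigma>\<^sup>2)"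
    by (simp add: power3_eq_cube power2_eq_square mult_ac)
  then have "32 * (B * norm l) \<le> \<beta> * \<sigma>\<^sup>2" using \<sigma> by simp
  moreover have "0 \<le> B * norm l" using B by simp
  ultimately have "B * norm l \<le> \<beta> * \<sigma>\<^sup>2 / 4" by linarith
  then have "B * norm l * (norm u)\<^sup>2 \<le> \<beta> * \<sigma>\<^sup>2 / 4 * (norm u)\<^sup>2" by (rule mult_right_mono) simp
  also have "\<dots> = \<beta> * (\<sigma> / 2 * norm u)\<^sup>2" by (simp add: power_mult_distrib power_divide)
  finally show ?thesis using low pen by linarith
qed

end

end

locale twice_differentiable_dissolving = constraint_dissolving f c A
  for f :: "real^'n \<Rightarrow> real" and c :: "real^'n \<Rightarrow> real^'p" and A :: "real^'n \<Rightarrow> real^'n" +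
  assumes grad_f_differentiable: "grad f differentiable (at y)"
    and trjac_c_differentiable: "trjac c differentiable (at y)"
    and trjac_A_differentiable: "trjac A differentiable (at y)"
begin

definition hess_lagrangian :: "real^'p \<Rightarrow> real^'n \<Rightarrow> real^'n^'n" where
  "hess_lagrangian l z = hess f z - (\<Sum>i\<in>UNIV. (l $ i) *\<^sub>R hess (\<lambda>y. c y $ i) z)"

text \<open>Differentiating the gradient \<open>JA y *v grad f (A y) + \<beta> *\<^sub>R (Jc y *v c y)\<close> produces the derivative of
\<open>JA\<close> applied to \<open>grad f z = Jc z *v l\<close>. The same expression occurs in the derivative \<open>D\<close> of
\<open>JA y *v (Jc (A y) *v l)\<close>, up to second derivatives of \<open>c\<close> along \<open>d v* JA z\<close>; exchanging one for the
other turns the Hessian of \<open>f\<close> into that of the Lagrangian. The term with the derivative of \<open>Jc\<close> in the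
penalty carries the factor \<open>c z = 0\<close>.\<close>

lemma hess_penalty_feasible:
  assumes z: "c z = 0" and l: "grad f z = Jc z *v l"
  obtains D where "(dissolved_normal l has_derivative D) (at z)"
    and "\<And>\<beta> d. d \<bullet> (hess (penalty \<beta> f c A) z *v d) =
      (d v* JA z) \<bullet> (hess_lagrangian l z *v (d v* JA z)) + d \<bullet> D d + \<beta> * (norm (d v* Jc z))\<^sup>2"
proof -
  note mv = bounded_bilinear.FDERIV[OF bounded_bilinear_matrix_vector_mult]
  note Az = A_fixes[OF z]
  obtain Hf where Hf: "(grad f has_derivative Hf) (at z)"
    using grad_f_differentiable unfolding differentiable_def by blast
  obtain Dc where Dc: "(Jc has_derivative Dc) (at z)"
    using trjac_c_differentiable unfolding differentiable_def by blast
  obtain DA where DA: "(JA has_derivative DA) (at z)"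
    using trjac_A_differentiable unfolding differentiable_def by blast
  have HfA: "((\<lambda>y. grad f (A y)) has_derivative (\<lambda>d. Hf (d v* JA z))) (at z)"
    by (rule has_derivative_compose[OF A_has_derivative]) (simp add: Az Hf)
  have DcA: "((\<lambda>y. Jc (A y)) has_derivative (\<lambda>d. Dc (d v* JA z))) (at z)"
    by (rule has_derivative_compose[OF A_has_derivative]) (simp add: Az Dc)
  define D where "D d = JA z *v (Dc (d v* JA z) *v l) + DA d *v (Jc z *v l)" for d
  have "((\<lambda>y. JA y *v (Jc (A y) *v l)) has_derivative D) (at z)"
    using mv[OF DA mv[OF DcA has_derivative_const[of l]]] by (simp add: D_def[abs_def] Az)
  then have 1: "(dissolved_normal l has_derivative D) (at z)"
    by (simp add: dissolved_normal_def[abs_def])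
  have 2: "d \<bullet> (hess (penalty \<beta> f c A) z *v d) =
      (d v* JA z) \<bullet> (hess_lagrangian l z *v (d v* JA z)) + d \<bullet> D d + \<beta> * (norm (d v* Jc z))\<^sup>2" for \<beta> d
  proof -
    define w where "w = d v* JA z"
    have grad_h: "grad (penalty \<beta> f c A) = (\<lambda>y. JA y *v grad f (A y) + \<beta> *\<^sub>R (Jc y *v c y))"
      by (rule ext) (rule grad_penalty)
    have "(grad (penalty \<beta> f c A) has_derivative
        (\<lambda>d. (JA z *v Hf (d v* JA z) + DA d *v grad f (A z)) + \<beta> *\<^sub>R (Jc z *v (d v* Jc z) + Dc d *v c z))) (at z)"
      unfolding grad_h
      by (intro has_derivative_add has_derivative_scaleR_right mv[OF DA HfA] mv[OF Dc c_has_derivative])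
    from hess_mult[OF this]
    have "hess (penalty \<beta> f c A) z *v d
        = JA z *v Hf w + DA d *v (Jc z *v l) + \<beta> *\<^sub>R (Jc z *v (d v* Jc z))"
      by (simp add: Az z l w_def)
    then have h: "d \<bullet> (hess (penalty \<beta> f c A) z *v d)
        = w \<bullet> Hf w + d \<bullet> (DA d *v (Jc z *v l)) + \<beta> * (norm (d v* Jc z))\<^sup>2"
      by (simp add: inner_add_right w_def dot_lmul_matrix power2_norm_eq_inner)
    have "(\<Sum>i\<in>UNIV. (l $ i) *\<^sub>R hess (\<lambda>y. c y $ i) z) *v w
        = (\<Sum>i\<in>UNIV. (l $ i) *\<^sub>R (hess (\<lambda>y. c y $ i) z *v w))"
      by (simp add: bounded_bilinear.sum_left[OF bounded_bilinear_matrix_vector_mult]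
          scaleR_matrix_vector_assoc)
    also have "\<dots> = Dc w *v l"
      by (simp add: hess_mult_component[OF c_differentiable Dc] column_sum_matrix_vector)
    finally have "hess_lagrangian l z *v w = Hf w - Dc w *v l"
      by (simp add: hess_lagrangian_def matrix_vector_mult_diff_rdistrib hess_mult[OF Hf])
    moreover have "d \<bullet> D d = w \<bullet> (Dc w *v l) + d \<bullet> (DA d *v (Jc z *v l))"
      by (simp add: D_def inner_add_right w_def dot_lmul_matrix)
    ultimately show ?thesis unfolding h w_def[symmetric] by (simp add: inner_diff_right)
  qed
  from 1 2 show ?thesis by (rule that)
qed

section \<open>Equivalence of second-order stationarity\<close>

lemma second_order_OCP_iff:
  assumes z: "c z = 0" and l: "grad f z = Jc z *v l"
  shows "second_order_OCP f c z \<longleftrightarrow> (\<forall>t. t v* Jc z = 0 \<longrightarrow> t \<bullet> (hess_lagrangian l z *v t) \<ge> 0)"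
  using assms first_order_OCP_iff[of z]
  by (auto simp: second_order_OCP_def multiplier_eq[OF z l] tangent_def hess_lagrangian_def)

theorem second_order_OCP_imp_CDF:
  assumes x: "c x = 0" and \<beta>: "\<beta> \<ge> beta_x f c A x" "\<beta> > 0"
    and z\<Omega>: "z \<in> Omega c A x" and OCP: "second_order_OCP f c z"
  shows "second_order_CDF \<beta> f c A z"
proof -
  obtain l where z: "c z = 0" and l: "grad f z = Jc z *v l"
    using OCP unfolding second_order_OCP_def first_order_OCP_iff by blast
  obtain D where D: "(dissolved_normal l has_derivative D) (at z)"
    and hess: "\<And>\<beta> d. d \<bullet> (hess (penalty \<beta> f c A) z *v d) =
      (d v* JA z) \<bullet> (hess_lagrangian l z *v (d v* JA z)) + d \<bullet> D d + \<beta> * (norm (d v* Jc z))\<^sup>2"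
    using hess_penalty_feasible[OF z l] by blast
  have "grad (penalty \<beta> f c A) z = 0"
    using A_dissolves[OF z] by (simp add: grad_penalty_feasible[OF z] l)
  moreover have "0 \<le> d \<bullet> (hess (penalty \<beta> f c A) z *v d)" for d
  proof -
    have "0 \<le> (d v* JA z) \<bullet> (hess_lagrangian l z *v (d v* JA z))"
      using OCP JA_image_tangent[OF z] second_order_OCP_iff[OF z l] by blast
    moreover have "0 \<le> d \<bullet> D d + \<beta> * (norm (d v* Jc z))\<^sup>2"
      by (rule dissolved_normal_curvature_bound[OF z D x OmegaD(1)[OF x z\<Omega>] \<beta> l])
    ultimately show ?thesis unfolding hess by linarith
  qed
  ultimately show ?thesis by (simp add: second_order_CDF_def)
qed

theorem second_order_CDF_imp_OCP:
  assumes x: "c x = 0" and \<beta>: "\<beta> \<ge> beta_x f c A x" "\<beta> > 0"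
    and y: "y \<in> Omega c A x" and CDF: "second_order_CDF \<beta> f c A y"
  shows "second_order_OCP f c y"
proof -
  have crit: "grad (penalty \<beta> f c A) y = 0" using CDF by (simp add: second_order_CDF_def)
  have cy: "c y = 0" by (rule critical_point_feasible[OF x \<beta> y crit])
  have "JA y *v grad f y = 0" using crit by (simp add: grad_penalty_feasible[OF cy])
  then obtain l where l: "grad f y = Jc y *v l" using JA_kernel[OF cy] by blast
  obtain D where D: "(dissolved_normal l has_derivative D) (at y)"
    and hess: "\<And>\<beta> d. d \<bullet> (hess (penalty \<beta> f c A) y *v d) =
      (d v* JA y) \<bullet> (hess_lagrangian l y *v (d v* JA y)) + d \<bullet> D d + \<beta> * (norm (d v* Jc y))\<^sup>2"
    using hess_penalty_feasible[OF cy l] by blast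
  have "0 \<le> t \<bullet> (hess_lagrangian l y *v t)" if t: "t v* Jc y = 0" for t
  proof -
    have "0 \<le> t \<bullet> (hess (penalty \<beta> f c A) y *v t)" using CDF by (simp add: second_order_CDF_def)
    then show ?thesis unfolding hess by (simp add: t JA_tangent[OF cy t] dissolved_normal_derivative_tangent[OF cy D t])
  qed
  then show ?thesis using second_order_OCP_iff[OF cy l] by blast
qed

end

theorem theorem3p11:
  fixes f :: "real^'n \<Rightarrow> real"
    and c :: "real^'n \<Rightarrow> real^'p"
    and A :: "real^'n \<Rightarrow> real^'n"
    and \<beta> :: real
  assumes "f differentiable_on UNIV" "c differentiable_on UNIV" "A differentiable_on UNIV"
    and "locally_lipschitz (grad f)" "locally_lipschitz (trjac c)" "locally_lipschitz (trjac A)"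
    and "\<And>x. x \<in> feasible_set c \<Longrightarrow> rank (trjac c x) = CARD('p)"
    and "\<And>x. x \<in> feasible_set c \<Longrightarrow> A x = x"
    and "\<And>x. x \<in> feasible_set c \<Longrightarrow> trjac A x ** trjac c x = 0"
    and "grad f differentiable_on UNIV" "trjac c differentiable_on UNIV"
        "trjac A differentiable_on UNIV"
    and "\<beta> > 0"
  shows "(\<forall>z. second_order_OCP f c z \<longrightarrow>
            (\<exists>x \<in> feasible_set c. \<beta> \<ge> beta_x f c A x \<and> z \<in> Omega c A x) \<longrightarrow>
            second_order_CDF \<beta> f c A z) \<and>
         (\<forall>x \<in> feasible_set c. \<beta> \<ge> beta_x f c A x \<longrightarrow>
            (\<forall>y \<in> Omega c A x. second_order_CDF \<beta> f c A y \<longrightarrow> second_order_OCP f c y))"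
proof -
  interpret twice_differentiable_dissolving f c A
  proof
    fix z v
    assume z: "c z = 0"
    then have zf: "z \<in> feasible_set c" by (simp add: feasible_set_def)
    show "inj ((*v) (trjac c z))" using assms(7)[OF zf] by (simp add: full_rank_injective)
    show "A z = z" by (rule assms(8)[OF zf])
    show "trjac A z *v (trjac c z *v v) = 0"
      by (simp add: matrix_vector_mul_assoc assms(9)[OF zf])
  qed (use assms in \<open>auto simp: differentiable_on_def\<close>)
  show ?thesis
    using second_order_OCP_imp_CDF second_order_CDF_imp_OCP \<open>\<beta> > 0\<close>
    by (auto simp: feasible_set_def)
qed

end
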